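(* Let $(\phi_t)$ be a hyperbolic semigroup in $\mathbb{D}$ which induces the semigroup of composition operators $(T_t)$ on the Dirichlet space $\mathcal{D}$. Let $\Omega$ be the Koenigs domain of $(\phi_t)$ and $\sigma_{\mathcal{D}}$ the point spectrum of the infinitesimal generator of $(T_t)$. For $x\in\mathbb{R}$ let $\ell_\Omega(x)$ be the Euclidean length (one-dimensional Lebesgue measure) of $\{y\in\mathbb{R}:x+iy\in\Omega\}$, and set $$W(\Omega)=\int_{-\infty}^0\ell_\Omega(x)\,dx,\qquad \delta_\Omega=\lim_{x\to-\infty}\frac{\log\ell_\Omega(x)}{2x},$$ the latter whenever the limit exists in $[0,+\infty]$. Then: (a) If $W(\Omega)=+\infty$, then $\sigma_{\mathcal{D}}=\{0\}$. (b) If $W(\Omega)<+\infty$ and $\delta_\Omega$ exists with $\delta_\Omega=+\infty$, then $\sigma_{\mathcal{D}}=\{\lambda\in\mathbb{C}:\mathrm{Re}\,\lambda<0\}\cup\{0\}$. (c) If $W(\Omega)<+\infty$, $\delta_\Omega$ exists with $\delta_\Omega\in(0,+\infty)$, and $\int_{-\infty}^0e^{-2\delta_\Omega x}\ell_\Omega(x)\,dx<+\infty$, then $\sigma_{\mathcal{D}}=\{\lambda\in\mathbb{C}:-\delta_\Omega\le\mathrm{Re}\,\lambda<0\}\cup\{0\}$. (d) If $W(\Omega)<+\infty$, $\delta_\Omega$ exists with $\delta_\Omega\in(0,+\infty)$, and $\int_{-\infty}^0e^{-2\delta_\Omega x}\ell_\Omega(x)\,dx=+\infty$, then $\sigma_{\mathcal{D}}=\{\lambda\in\mathbb{C}:-\delta_\Omega<\mathrm{Re}\,\lambda<0\}\cup\{0\}$.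 (e) If $W(\Omega)<+\infty$ and $\delta_\Omega$ exists with $\delta_\Omega=0$, then $\sigma_{\mathcal{D}}=\{0\}$.
   Context: $\mathbb{D}$ is the open unit disk. A semigroup in $\mathbb{D}$ is a family $(\phi_t)_{t\ge0}$ of holomorphic maps $\phi_t:\mathbb{D}\to\mathbb{D}$ with $\phi_0=\mathrm{id}$, $\phi_{t+s}=\phi_t\circ\phi_s$ for all $t,s\ge0$, and $\phi_t(z)\to z$ uniformly on compacta as $t\to0^+$. It is non-elliptic if there is $\tau\in\partial\mathbb{D}$ (the Denjoy–Wolff point) with $\phi_t(z)\to\tau$ as $t\to+\infty$ for all $z\in\mathbb{D}$; a non-elliptic semigroup is hyperbolic if the angular derivative satisfies $\phi_1'(\tau)\in(0,1)$. For a non-elliptic semigroup there is a univalent map $h:\mathbb{D}\to\mathbb{C}$, unique up to translation, the Koenigs function, with $h(\phi_t(z))=h(z)+t$ for all $t\ge0$, $z\in\mathbb{D}$; $\Omega:=h(\mathbb{D})$ is the Koenigs domain. For hyperbolic semigroups $\Omega$ is contained in a horizontal strip, so $\ell_\Omega$ is bounded. Convention: $\log 0=-\infty$, so $\log\ell_\Omega(x)/(2x)=+\infty$ if $\ell_\Omega(x)=0$ and $x<0$. The Dirichlet space $\mathcal{D}$ is the space of holomorphic $f:\mathbb{D}\to\mathbb{C}$ with $\int_{\mathbb{D}}|f'(z)|^2\,dA(z)<+\infty$ ($dA$ normalized area measure), with its usual norm. $T_t(f)=f\circ\phi_t$, $f\in\mathcal{D}$, is a strongly continuous semigroup of bounded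 operators; its infinitesimal generator is $\Gamma_{\mathcal{D}}(f)=\lim_{t\to0^+}(T_t(f)-f)/t$ (norm limit), defined on those $f\in\mathcal{D}$ for which the limit exists in $\mathcal{D}$. The point spectrum is the set of eigenvalues $\lambda\in\mathbb{C}$ of $\Gamma_{\mathcal{D}}$. *)

theory Defs
  imports "HOL-Complex_Analysis.Complex_Analysis"
begin

abbreviation unit_disk :: "complex set"
  where "unit_disk \<equiv> ball 0 1"


section \<open>Semigroups of holomorphic self-maps of the disk\<close>

text \<open>Only the values \<open>\<phi> t z\<close> with \<open>t \<ge> 0\<close> and \<open>z\<close> in the disk are meaningful.\<close>

definition holomorphic_semigroup :: "(real \<Rightarrow> complex \<Rightarrow> complex) \<Rightarrow> bool" where
  "holomorphic_semigroup \<phi> \<longleftrightarrow>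
     (\<forall>t\<ge>0. \<phi> t holomorphic_on unit_disk \<and> \<phi> t ` unit_disk \<subseteq> unit_disk) \<and>
     (\<forall>z\<in>unit_disk. \<phi> 0 z = z) \<and>
     (\<forall>t\<ge>0. \<forall>s\<ge>0. \<forall>z\<in>unit_disk. \<phi> (t + s) z = \<phi> t (\<phi> s z)) \<and>
     (\<forall>K. compact K \<and> K \<subseteq> unit_disk \<longrightarrow> uniform_limit K \<phi> (\<lambda>z. z) (at_right 0))"

definition denjoy_wolff_point :: "(real \<Rightarrow> complex \<Rightarrow> complex) \<Rightarrow> complex \<Rightarrow> bool" where
  "denjoy_wolff_point \<phi> \<tau> \<longleftrightarrow>
     \<tau> \<in> sphere 0 1 \<and> (\<forall>z\<in>unit_disk. ((\<lambda>t. \<phi> t z) \<longlongrightarrow> \<tau>) at_top)"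

definition non_elliptic_semigroup :: "(real \<Rightarrow> complex \<Rightarrow> complex) \<Rightarrow> bool" where
  "non_elliptic_semigroup \<phi> \<longleftrightarrow> holomorphic_semigroup \<phi> \<and> (\<exists>\<tau>. denjoy_wolff_point \<phi> \<tau>)"

definition stolz_region :: "complex \<Rightarrow> real \<Rightarrow> complex set" where
  "stolz_region \<tau> M = {z \<in> unit_disk. cmod (\<tau> - z) < M * (1 - cmod z)}"

definition has_angular_limit :: "(complex \<Rightarrow> complex) \<Rightarrow> complex \<Rightarrow> complex \<Rightarrow> bool" where
  "has_angular_limit f \<tau> l \<longleftrightarrow> (\<forall>M>1. (f \<longlongrightarrow> l) (at \<tau> within stolz_region \<tau> M))"

definition has_angular_derivative :: "(complex \<Rightarrow> complex) \<Rightarrow> complex \<Rightarrow> complex \<Rightarrow> bool" where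
  "has_angular_derivative f \<tau> d \<longleftrightarrow>
     (\<exists>\<eta>. has_angular_limit f \<tau> \<eta> \<and> has_angular_limit (\<lambda>z. (f z - \<eta>) / (z - \<tau>)) \<tau> d)"

definition hyperbolic_semigroup :: "(real \<Rightarrow> complex \<Rightarrow> complex) \<Rightarrow> bool" where
  "hyperbolic_semigroup \<phi> \<longleftrightarrow>
     non_elliptic_semigroup \<phi> \<and>
     (\<exists>\<tau> d. denjoy_wolff_point \<phi> \<tau> \<and> d \<in> {0<..<1::real} \<and>
        has_angular_derivative (\<phi> 1) \<tau> (of_real d))"

definition koenigs_function ::
  "(real \<Rightarrow> complex \<Rightarrow> complex) \<Rightarrow> (complex \<Rightarrow> complex) \<Rightarrow> bool" where
  "koenigs_function \<phi> h \<longleftrightarrow>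
     h holomorphic_on unit_disk \<and> inj_on h unit_disk \<and>
     (\<forall>t\<ge>0. \<forall>z\<in>unit_disk. h (\<phi> t z) = h z + of_real t)"


section \<open>Composition operators on the Dirichlet space\<close>

text \<open>
  Elements of the Dirichlet space are represented by arbitrary extensions to the plane;
  two representatives are identified when they agree on the disk.
\<close>

definition dirichlet_space :: "(complex \<Rightarrow> complex) set" where
  "dirichlet_space =
     {f. f holomorphic_on unit_disk \<and>
         set_integrable lborel unit_disk (\<lambda>z. (cmod (deriv f z))\<^sup>2)}"

text \<open>The factor \<open>1 / pi\<close> normalizes the area measure of the disk.\<close>

definition dirichlet_norm :: "(complex \<Rightarrow> complex) \<Rightarrow> real" where
  "dirichlet_norm f =
     sqrt ((cmod (f 0))\<^sup>2 + (1 / pi) * (LINT z:unit_disk|lborel. (cmod (deriv f z))\<^sup>2))"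

text \<open>
  Norm convergence in the Dirichlet space. Membership is demanded explicitly because the norm
  above has a meaningless value outside the space.
\<close>

definition dirichlet_tendsto ::
  "('i \<Rightarrow> complex \<Rightarrow> complex) \<Rightarrow> (complex \<Rightarrow> complex) \<Rightarrow> 'i filter \<Rightarrow> bool" where
  "dirichlet_tendsto F g A \<longleftrightarrow>
     g \<in> dirichlet_space \<and> (\<forall>\<^sub>F i in A. F i \<in> dirichlet_space) \<and>
     ((\<lambda>i. dirichlet_norm (\<lambda>z. F i z - g z)) \<longlongrightarrow> 0) A"

definition composition_op ::
  "(real \<Rightarrow> complex \<Rightarrow> complex) \<Rightarrow> real \<Rightarrow> (complex \<Rightarrow> complex) \<Rightarrow> complex \<Rightarrow> complex" where
  "composition_op \<phi> t f = f \<circ> \<phi> t"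

text \<open>
  The graph of the infinitesimal generator: \<open>f\<close> lies in its domain and \<open>g\<close> represents its
  value at \<open>f\<close>.
\<close>

definition dirichlet_generator ::
  "(real \<Rightarrow> complex \<Rightarrow> complex) \<Rightarrow> (complex \<Rightarrow> complex) \<Rightarrow> (complex \<Rightarrow> complex) \<Rightarrow> bool" where
  "dirichlet_generator \<phi> f g \<longleftrightarrow>
     f \<in> dirichlet_space \<and>
     dirichlet_tendsto (\<lambda>t z. (composition_op \<phi> t f z - f z) / of_real t) g (at_right 0)"

definition dirichlet_point_spectrum :: "(real \<Rightarrow> complex \<Rightarrow> complex) \<Rightarrow> complex set" where
  "dirichlet_point_spectrum \<phi> =
     {\<mu>. \<exists>f. (\<exists>z\<in>unit_disk. f z \<noteq> 0) \<and> dirichlet_generator \<phi> f (\<lambda>z. \<mu> * f z)}"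


section \<open>Geometry of the Koenigs domain\<close>

definition slice_length :: "complex set \<Rightarrow> real \<Rightarrow> ennreal" where
  "slice_length \<Omega> x = emeasure lborel {y. Complex x y \<in> \<Omega>}"

definition left_area :: "complex set \<Rightarrow> ennreal" where
  "left_area \<Omega> = (\<integral>\<^sup>+ x\<in>{..0}. slice_length \<Omega> x \<partial>lborel)"

definition ext_log :: "ennreal \<Rightarrow> ereal" where
  "ext_log u = (if u = 0 then - \<infinity> else if u = \<infinity> then \<infinity> else ereal (ln (enn2real u)))"

text \<open>
  \<open>has_decay_rate \<Omega> \<delta>\<close> says that the limit defining \<open>\<delta>\<^sub>\<Omega>\<close> exists in \<open>[0, \<infinity>]\<close> and equals
  \<open>\<delta>\<close>. For \<open>x < 0\<close> the extended-real quotient \<open>- \<infinity> / ereal (2 * x)\<close> is \<open>\<infinity>\<close>, so empty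
  slices are treated as required by the convention \<open>log 0 = - \<infinity>\<close>.
\<close>

definition has_decay_rate :: "complex set \<Rightarrow> ereal \<Rightarrow> bool" where
  "has_decay_rate \<Omega> \<delta> \<longleftrightarrow>
     0 \<le> \<delta> \<and> ((\<lambda>x. ext_log (slice_length \<Omega> x) / ereal (2 * x)) \<longlongrightarrow> \<delta>) at_bot"

lemma ext_log_zero_quotient: "x < 0 \<Longrightarrow> ext_log 0 / ereal (2 * x) = \<infinity>"
  by (simp add: ext_log_def divide_ereal_def)

definition weighted_left_area :: "complex set \<Rightarrow> real \<Rightarrow> ennreal" where
  "weighted_left_area \<Omega> \<delta> =
     (\<integral>\<^sup>+ x\<in>{..0}. ennreal (exp (- 2 * \<delta> * x)) * slice_length \<Omega> x \<partial>lborel)"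

end

theory Submission
  imports Defs
begin

text \<open>
  Write \<open>\<Omega>\<close> for the Koenigs domain. In the coordinate \<open>w = h z\<close> the semigroup acts by translations
  \<open>w \<mapsto> w + t\<close>, so an eigenfunction of the generator with eigenvalue \<open>\<mu>\<close> must be a multiple of
  \<open>exp (\<mu> w)\<close> (lemma \<open>generator_eigenfunction\<close>), and conversely \<open>exp (\<mu> h)\<close> is an eigenfunction as soon
  as it belongs to the Dirichlet space. Since \<open>h\<close> is univalent, its Dirichlet integral is
  \<open>|\<mu>|\<^sup>2\<close> times the integral of \<open>exp (2 Re (\<mu> w))\<close> over \<open>\<Omega>\<close>.

  The hyperbolic case is special because \<open>\<Omega>\<close> lies in a horizontal strip
  (\<open>hyperbolic_koenigs_domain_in_strip\<close>): by Julia's lemma the Poisson kernel at the Denjoy--Wolff point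
  grows by a definite factor with each unit of time, whereas by Harnack's inequality it could grow
  only by a factor close to \<open>1\<close> inside a large ball contained in \<open>\<Omega>\<close>. In a strip only \<open>Re \<mu>\<close> matters for
  the size of \<open>exp (\<mu> w)\<close>, and by Tonelli the question becomes whether the integral of
  \<open>exp (2 Re \<mu> x)\<close> times the slice length converges. On the right the slice lengths are bounded and
  bounded away from zero, which forces \<open>Re \<mu> < 0\<close>. On the left the integral is a weighted area, so
  \<open>\<mu> \<noteq> 0\<close> is an eigenvalue exactly when \<open>Re \<mu> < 0\<close> and the left area with weight
  \<open>exp (2 Re \<mu> x)\<close> is finite (\<open>dirichlet_point_spectrum_iff\<close>).

  If the left area is infinite, so are all these weighted areas, because the weight is at least \<open>1\<close>
  there. The other cases compare \<open>- Re \<mu>\<close> with the exponential decay rate of the slice lengths: below the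
  rate the weighted area is finite, above it infinite, and at the rate itself the hypothesis decides.
\<close>


section \<open>The lemmas of Schwarz--Pick, Julia and Wolff\<close>

lemma mobius_identity:
  fixes w z :: complex
  shows "(cmod (1 - cnj w * z))\<^sup>2 - (cmod (z - w))\<^sup>2 = (1 - (cmod w)\<^sup>2) * (1 - (cmod z)\<^sup>2)"
  unfolding cmod_power2 by (simp add: power2_eq_square algebra_simps)

lemma one_minus_cnj_mult_nonzero:
  assumes "cmod w < 1" "cmod z < 1"
  shows "1 - cnj w * z \<noteq> 0"
proof
  assume "1 - cnj w * z = 0"
  then have "cmod (cnj w * z) = 1"
    by simp
  moreover have "cmod (cnj w * z) < 1"
    using mult_le_less_imp_less[of "cmod w" 1 "cmod z" 1] assms
    by (cases "w = 0") (auto simp: norm_mult)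
  ultimately show False by simp
qed

lemma mobius_in_disk:
  assumes "cmod w < 1" "cmod z < 1"
  shows "cmod ((z - w) / (1 - cnj w * z)) < 1"
proof -
  have "(cmod w)\<^sup>2 < 1" "(cmod z)\<^sup>2 < 1"
    using assms by (simp_all add: abs_square_less_1)
  then have "0 < (1 - (cmod w)\<^sup>2) * (1 - (cmod z)\<^sup>2)"
    by simp
  then have "(cmod (z - w))\<^sup>2 < (cmod (1 - cnj w * z))\<^sup>2"
    using mobius_identity[of w z] by linarith
  then have "cmod (z - w) < cmod (1 - cnj w * z)"
    by (rule power2_less_imp_less) simp
  then show ?thesis
    using one_minus_cnj_mult_nonzero[OF assms] by (simp add: norm_divide)
qed

text \<open>
  Schwarz's lemma applied to \<open>f\<close> conjugated by the disk automorphisms that move \<open>a\<close> and \<open>f a\<close> to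
  the origin. The inequality is cleared of denominators, so that a base point \<open>a\<close> can be sent to the
  unit circle, where both sides of the usual quotient form degenerate.
\<close>

lemma Schwarz_Pick:
  assumes holf: "f holomorphic_on unit_disk" and fim: "f ` unit_disk \<subseteq> unit_disk"
    and a: "a \<in> unit_disk" and z: "z \<in> unit_disk"
  shows "(cmod (1 - cnj (f a) * f z))\<^sup>2 * ((1 - (cmod a)\<^sup>2) * (1 - (cmod z)\<^sup>2))
       \<le> (cmod (1 - cnj a * z))\<^sup>2 * ((1 - (cmod (f a))\<^sup>2) * (1 - (cmod (f z))\<^sup>2))"
proof -
  define m where "m w z = (z - w) / (1 - cnj w * z)" for w z :: complex
  have m_hol: "m w holomorphic_on unit_disk" if "cmod w < 1" for w
    unfolding m_def using one_minus_cnj_mult_nonzero[OF that]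
    by (intro holomorphic_intros) auto
  have m_im: "m w z \<in> unit_disk" if "cmod w < 1" "z \<in> unit_disk" for w z
    using mobius_in_disk[of w z] that by (simp add: m_def)
  have fa: "cmod (f a) < 1" and fz: "cmod (f z) < 1"
    using fim a z by (auto simp: image_subset_iff)
  have a1: "cmod a < 1" "cmod (- a) < 1" and z1: "cmod z < 1" using a z by auto
  define g where "g = m (f a) \<circ> (f \<circ> m (- a))"
  have "f \<circ> m (- a) holomorphic_on unit_disk"
    by (rule holomorphic_on_compose_gen[OF m_hol holf]) (use m_im a1 in auto)
  then have "g holomorphic_on unit_disk"
    unfolding g_def
    by (rule holomorphic_on_compose_gen[OF _ m_hol[OF fa]]) (use m_im a1 fim in auto)
  moreover have "g 0 = 0"
    by (simp add: g_def m_def)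
  moreover have "cmod (g \<zeta>) < 1" if "cmod \<zeta> < 1" for \<zeta>
  proof -
    have "f (m (- a) \<zeta>) \<in> unit_disk"
      using subsetD[OF fim imageI[OF m_im[OF a1(2), of \<zeta>]]] that by simp
    then have "g \<zeta> \<in> unit_disk"
      unfolding g_def using m_im[OF fa] by simp
    then show ?thesis by simp
  qed
  moreover have "cmod (m a z) < 1"
    using m_im[OF a1(1) z] by simp
  ultimately have "cmod (g (m a z)) \<le> cmod (m a z)"
    using Schwarz_Lemma(1) by blast
  moreover have "m (- a) (m a z) = z"
  proof -
    have n: "1 - cnj a * z \<noteq> 0" "1 - cnj a * a \<noteq> 0"
      using one_minus_cnj_mult_nonzero a1 z1 by auto
    have "m a z + a = z * (1 - cnj a * a) / (1 - cnj a * z)"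
      using n by (simp add: m_def field_simps)
    moreover have "1 + cnj a * m a z = (1 - cnj a * a) / (1 - cnj a * z)"
      using n by (simp add: m_def field_simps)
    moreover have "m (- a) (m a z) = (m a z + a) / (1 + cnj a * m a z)"
      by (simp add: m_def)
    ultimately show ?thesis using n by simp
  qed
  ultimately have "cmod (m (f a) (f z)) \<le> cmod (m a z)"
    by (simp add: g_def)
  then have "cmod (f z - f a) * cmod (1 - cnj a * z) \<le> cmod (z - a) * cmod (1 - cnj (f a) * f z)"
    using one_minus_cnj_mult_nonzero[OF a1(1) z1] one_minus_cnj_mult_nonzero[OF fa fz]
    by (simp add: m_def norm_divide divide_simps)
  then have "(cmod (f z - f a) * cmod (1 - cnj a * z))\<^sup>2 \<le> (cmod (z - a) * cmod (1 - cnj (f a) * f z))\<^sup>2"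
    by (intro power_mono) auto
  then have "(cmod (f z - f a))\<^sup>2 * (cmod (1 - cnj a * z))\<^sup>2 \<le> (cmod (z - a))\<^sup>2 * (cmod (1 - cnj (f a) * f z))\<^sup>2"
    by (simp add: power_mult_distrib)
  moreover have "(cmod (z - a))\<^sup>2 = (cmod (1 - cnj a * z))\<^sup>2 - (1 - (cmod a)\<^sup>2) * (1 - (cmod z)\<^sup>2)"
    "(cmod (f z - f a))\<^sup>2 = (cmod (1 - cnj (f a) * f z))\<^sup>2 - (1 - (cmod (f a))\<^sup>2) * (1 - (cmod (f z))\<^sup>2)"
    using mobius_identity[of a z] mobius_identity[of "f a" "f z"] by linarith+
  moreover have "A * \<beta> \<le> B * \<alpha>" if "(A - \<alpha>) * B \<le> (B - \<beta>) * A" for A B \<alpha> \<beta> :: real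
    using that by (simp add: algebra_simps)
  ultimately show ?thesis by metis
qed

text \<open>
  The limit of the Schwarz--Pick inequality as the base points \<open>x n\<close> approach the boundary. The
  sequence can come from an angular derivative, with points on a radius, or from an orbit that
  converges to the boundary.
\<close>

lemma Julia_lemma:
  assumes holf: "f holomorphic_on unit_disk" and fim: "f ` unit_disk \<subseteq> unit_disk"
    and x: "\<And>n::nat. x n \<in> unit_disk"
    and xlim: "x \<longlonglongrightarrow> \<tau>" and flim: "(\<lambda>n. f (x n)) \<longlonglongrightarrow> \<sigma>"
    and unimod: "cmod \<tau> = 1" "cmod \<sigma> = 1"
    and quot: "\<And>n. 1 - (cmod (f (x n)))\<^sup>2 \<le> c n * (1 - (cmod (x n))\<^sup>2)" and clim: "c \<longlonglongrightarrow> L"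
    and z: "z \<in> unit_disk"
  shows "(cmod (\<sigma> - f z))\<^sup>2 * (1 - (cmod z)\<^sup>2) \<le> L * ((cmod (\<tau> - z))\<^sup>2 * (1 - (cmod (f z))\<^sup>2))"
proof -
  have unimod_dist: "cmod (1 - cnj s * w) = cmod (s - w)" if "cmod s = 1" for s w
  proof -
    have "cnj s * s = 1"
      using that by (metis complex_norm_square mult.commute of_real_1 one_power2)
    then have "1 - cnj s * w = cnj s * (s - w)"
      by (simp add: algebra_simps)
    then show ?thesis using that by (simp add: norm_mult)
  qed
  have fz: "1 - (cmod (f z))\<^sup>2 \<ge> 0"
    using fim z by (auto simp: image_subset_iff abs_square_le_1 less_imp_le)
  have bound: "(cmod (1 - cnj (f (x n)) * f z))\<^sup>2 * (1 - (cmod z)\<^sup>2)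
      \<le> c n * ((cmod (1 - cnj (x n) * z))\<^sup>2 * (1 - (cmod (f z))\<^sup>2))" for n
  proof -
    have pos: "1 - (cmod (x n))\<^sup>2 > 0"
      using x[of n] by (simp add: abs_square_less_1)
    have "(cmod (1 - cnj (f (x n)) * f z))\<^sup>2 * ((1 - (cmod (x n))\<^sup>2) * (1 - (cmod z)\<^sup>2))
        \<le> (cmod (1 - cnj (x n) * z))\<^sup>2 * ((1 - (cmod (f (x n)))\<^sup>2) * (1 - (cmod (f z))\<^sup>2))"
      by (rule Schwarz_Pick[OF holf fim x z])
    also have "\<dots> \<le> (cmod (1 - cnj (x n) * z))\<^sup>2 * ((c n * (1 - (cmod (x n))\<^sup>2)) * (1 - (cmod (f z))\<^sup>2))"
      by (intro mult_left_mono mult_right_mono quot fz) auto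
    finally have "(1 - (cmod (x n))\<^sup>2) * ((cmod (1 - cnj (f (x n)) * f z))\<^sup>2 * (1 - (cmod z)\<^sup>2))
        \<le> (1 - (cmod (x n))\<^sup>2) * (c n * ((cmod (1 - cnj (x n) * z))\<^sup>2 * (1 - (cmod (f z))\<^sup>2)))"
      by (simp add: mult_ac)
    then show ?thesis using pos by simp
  qed
  have "(\<lambda>n. (cmod (1 - cnj (f (x n)) * f z))\<^sup>2 * (1 - (cmod z)\<^sup>2))
      \<longlonglongrightarrow> (cmod (1 - cnj \<sigma> * f z))\<^sup>2 * (1 - (cmod z)\<^sup>2)"
    by (intro tendsto_intros flim)
  moreover have "(\<lambda>n. c n * ((cmod (1 - cnj (x n) * z))\<^sup>2 * (1 - (cmod (f z))\<^sup>2)))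
      \<longlonglongrightarrow> L * ((cmod (1 - cnj \<tau> * z))\<^sup>2 * (1 - (cmod (f z))\<^sup>2))"
    by (intro tendsto_intros xlim clim)
  ultimately have "(cmod (1 - cnj \<sigma> * f z))\<^sup>2 * (1 - (cmod z)\<^sup>2)
      \<le> L * ((cmod (1 - cnj \<tau> * z))\<^sup>2 * (1 - (cmod (f z))\<^sup>2))"
    by (rule LIMSEQ_le) (use bound in blast)
  then show ?thesis
    by (simp only: unimod_dist unimod)
qed

text \<open>
  Moduli along an orbit that tends to the unit circle cannot decrease at all late times, and at the other
  times the dilation is at most \<open>1\<close>. Julia's lemma along these times shows that the horodisks at \<open>\<tau>\<close> are invariant.
\<close>

lemma Wolff_lemma:
  assumes holf: "f holomorphic_on unit_disk" and fim: "f ` unit_disk \<subseteq> unit_disk"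
    and x: "\<And>n::nat. x n \<in> unit_disk" and orbit: "\<And>n. x (Suc n) = f (x n)"
    and xlim: "x \<longlonglongrightarrow> \<tau>" and \<tau>: "cmod \<tau> = 1"
    and z: "z \<in> unit_disk"
  shows "(cmod (\<tau> - f z))\<^sup>2 * (1 - (cmod z)\<^sup>2) \<le> (cmod (\<tau> - z))\<^sup>2 * (1 - (cmod (f z))\<^sup>2)"
proof -
  have "\<exists>m\<ge>n. cmod (x m) \<le> cmod (x (Suc m))" for n
  proof (rule ccontr)
    assume "\<not> ?thesis"
    then have dec: "cmod (x (Suc m)) \<le> cmod (x m)" if "m \<ge> n" for m
      using that by force
    have "cmod (x m) \<le> cmod (x n)" if "m \<ge> n" for m
      using that by (induction m rule: dec_induct) (use dec in \<open>auto intro: order_trans\<close>)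
    moreover have "(\<lambda>m. cmod (x m)) \<longlonglongrightarrow> 1"
      using tendsto_norm[OF xlim] \<tau> by simp
    ultimately have "1 \<le> cmod (x n)"
      by (meson LIMSEQ_le_const2)
    then show False using x[of n] by simp
  qed
  then obtain k where k: "\<And>n. k n \<ge> n" "\<And>n. cmod (x (k n)) \<le> cmod (x (Suc (k n)))"
    by metis
  have klim: "filterlim k sequentially sequentially"
    by (rule filterlim_at_top_mono[OF filterlim_ident]) (use k in auto)
  have lim1: "(\<lambda>n. x (k n)) \<longlonglongrightarrow> \<tau>"
    by (rule filterlim_compose[OF xlim klim])
  have lim2: "(\<lambda>n. f (x (k n))) \<longlonglongrightarrow> \<tau>"
    using filterlim_compose[OF LIMSEQ_Suc[OF xlim] klim] by (simp add: orbit)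
  have "(cmod (\<tau> - f z))\<^sup>2 * (1 - (cmod z)\<^sup>2) \<le> 1 * ((cmod (\<tau> - z))\<^sup>2 * (1 - (cmod (f z))\<^sup>2))"
    by (rule Julia_lemma[OF holf fim _ lim1 lim2 \<tau> \<tau> _ tendsto_const z])
       (use k(2) x in \<open>auto simp: orbit[symmetric] intro!: power_mono\<close>)
  then show ?thesis by simp
qed

text \<open>
  The angular limit \<open>\<eta>\<close> in the definition of the angular derivative is not prescribed to be \<open>\<tau>\<close>.
  Wolff's lemma forces \<open>\<eta> = \<tau>\<close>: along the radius the horodisks shrink to \<open>\<tau>\<close>. After that, the radial
  difference quotients bound the dilation asymptotically by \<open>d\<close>, and Julia's lemma applies.
\<close>

lemma hyperbolic_Julia_inequality:
  assumes "hyperbolic_semigroup \<phi>"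
  obtains \<tau> d where "cmod \<tau> = 1" "0 < d" "d < 1"
    "\<And>z. z \<in> unit_disk \<Longrightarrow>
       (cmod (\<tau> - \<phi> 1 z))\<^sup>2 * (1 - (cmod z)\<^sup>2) \<le> d * ((cmod (\<tau> - z))\<^sup>2 * (1 - (cmod (\<phi> 1 z))\<^sup>2))"
proof -
  obtain \<tau> d where dw: "denjoy_wolff_point \<phi> \<tau>" and d: "0 < d" "d < 1"
    and der: "has_angular_derivative (\<phi> 1) \<tau> (of_real d)" and ne: "non_elliptic_semigroup \<phi>"
    using assms by (auto simp: hyperbolic_semigroup_def)
  have sg: "holomorphic_semigroup \<phi>"
    using ne by (simp add: non_elliptic_semigroup_def)
  define f where "f = \<phi> 1"
  have holf: "f holomorphic_on unit_disk" and fim: "f ` unit_disk \<subseteq> unit_disk"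
    using sg by (auto simp: holomorphic_semigroup_def f_def)
  have \<tau>: "cmod \<tau> = 1" using dw by (simp add: denjoy_wolff_point_def)
  obtain \<eta> where \<eta>: "has_angular_limit f \<tau> \<eta>"
    and quot: "has_angular_limit (\<lambda>z. (f z - \<eta>) / (z - \<tau>)) \<tau> (of_real d)"
    using der by (auto simp: has_angular_derivative_def f_def)
  define x where "x n = \<phi> (real n) 0" for n
  have x: "x n \<in> unit_disk" for n
    using sg by (force simp: holomorphic_semigroup_def x_def image_subset_iff)
  have "x (Suc n) = f (x n)" for n
    using sg by (simp add: holomorphic_semigroup_def x_def f_def)
  moreover have "x \<longlonglongrightarrow> \<tau>"
    using dw unfolding x_def denjoy_wolff_point_def
    by (auto intro: filterlim_compose[OF _ filterlim_real_sequentially])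
  ultimately have wolff: "(cmod (\<tau> - f z))\<^sup>2 * (1 - (cmod z)\<^sup>2) \<le> (cmod (\<tau> - z))\<^sup>2 * (1 - (cmod (f z))\<^sup>2)"
    if "z \<in> unit_disk" for z
    by (intro Wolff_lemma[OF holf fim, of x]) (use x \<tau> that in auto)
  \<comment> \<open>The points \<open>y n = (1 - e n) \<tau>\<close> on the radius lie in every Stolz region with aperture above \<open>1\<close>.\<close>
  define e where "e n = inverse (real (Suc (Suc n)))" for n
  have e: "0 < e n" "e n < 1" for n
    by (auto simp: e_def field_simps)
  have elim: "e \<longlonglongrightarrow> 0"
    unfolding e_def using LIMSEQ_Suc[OF LIMSEQ_inverse_real_of_nat] .
  define y where "y n = of_real (1 - e n) * \<tau>" for n
  have normy: "cmod (y n) = 1 - e n" for n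
    using e[of n] \<tau> by (simp add: y_def norm_mult del: of_real_diff)
  have y: "y n \<in> unit_disk" for n
    using e[of n] normy[of n] by simp
  have yd: "cmod (y n - \<tau>) = e n" "cmod (\<tau> - y n) = e n" for n
  proof -
    have "y n - \<tau> = - of_real (e n) * \<tau>" by (simp add: y_def algebra_simps)
    then show "cmod (y n - \<tau>) = e n" using \<tau> e(1)[of n] by (simp add: norm_mult)
    then show "cmod (\<tau> - y n) = e n" by (simp add: norm_minus_commute)
  qed
  have ylim: "y \<longlonglongrightarrow> \<tau>"
    using tendsto_mult[OF tendsto_of_real[OF tendsto_diff[OF tendsto_const[of 1] elim]] tendsto_const[of \<tau>]]
    by (simp add: y_def[abs_def])
  have "filterlim y (at \<tau> within stolz_region \<tau> 2) sequentially"
    unfolding filterlim_at using ylim y yd normy e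
    by (auto simp: stolz_region_def intro!: always_eventually) (metis less_irrefl norm_zero right_minus_eq)
  then have radial: "(\<lambda>n. g (y n)) \<longlonglongrightarrow> l" if "has_angular_limit g \<tau> l" for g l
    by (rule filterlim_compose[where g = g, rotated]) (use that in \<open>auto simp: has_angular_limit_def\<close>)
  have "(\<lambda>n. f (y n)) \<longlonglongrightarrow> \<tau>"
  proof -
    have "(cmod (\<tau> - f (y n)))\<^sup>2 \<le> e n" for n
    proof -
      have "(cmod (\<tau> - f (y n)))\<^sup>2 * (1 - (1 - e n)\<^sup>2) \<le> (e n)\<^sup>2 * (1 - (cmod (f (y n)))\<^sup>2)"
        using wolff[OF y[of n]] by (simp add: normy yd)
      also have "\<dots> \<le> (e n)\<^sup>2"
        by (intro mult_right_le_one_le) (use fim y[of n] in \<open>auto simp: image_subset_iff abs_square_le_1 less_imp_le\<close>)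
      finally have "e n * ((cmod (\<tau> - f (y n)))\<^sup>2 * (2 - e n)) \<le> e n * e n"
        by (simp add: power2_eq_square algebra_simps)
      then have "(cmod (\<tau> - f (y n)))\<^sup>2 * (2 - e n) \<le> e n"
        using e(1)[of n] by simp
      moreover have "(cmod (\<tau> - f (y n)))\<^sup>2 * 1 \<le> (cmod (\<tau> - f (y n)))\<^sup>2 * (2 - e n)"
        using e(2)[of n] by (intro mult_left_mono) auto
      ultimately show ?thesis by simp
    qed
    then have "(\<lambda>n. (cmod (\<tau> - f (y n)))\<^sup>2) \<longlonglongrightarrow> 0"
      by (intro tendsto_sandwich[OF _ _ tendsto_const elim]) auto
    then have "(\<lambda>n. \<tau> - f (y n)) \<longlonglongrightarrow> 0"
      using tendsto_real_sqrt[of "\<lambda>n. (cmod (\<tau> - f (y n)))\<^sup>2" 0] by (simp add: tendsto_norm_zero_iff)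
    then show ?thesis
      using tendsto_diff[OF tendsto_const[of \<tau>]] by fastforce
  qed
  moreover have "(\<lambda>n. f (y n)) \<longlonglongrightarrow> \<eta>"
    by (rule radial[OF \<eta>])
  ultimately have "\<eta> = \<tau>"
    using LIMSEQ_unique by blast
  have flim: "(\<lambda>n. f (y n)) \<longlonglongrightarrow> \<tau>" by fact
  \<comment> \<open>Upper bound for the dilation at \<open>y n\<close>, from \<open>1 - |f (y n)| \<le> |f (y n) - \<tau>|\<close>.\<close>
  define c where "c n = cmod ((f (y n) - \<tau>) / (y n - \<tau>)) * ((1 + cmod (f (y n))) / (1 + cmod (y n)))" for n
  have "c \<longlonglongrightarrow> cmod (of_real d) * ((1 + cmod \<tau>) / (1 + cmod \<tau>))"
    unfolding c_def using \<tau> radial[OF quot] \<open>\<eta> = \<tau>\<close>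
    by (intro tendsto_intros flim ylim) auto
  then have clim: "c \<longlonglongrightarrow> d" using \<tau> d by simp
  have cq: "1 - (cmod (f (y n)))\<^sup>2 \<le> c n * (1 - (cmod (y n))\<^sup>2)" for n
  proof -
    have "1 - cmod (f (y n)) \<le> cmod (f (y n) - \<tau>)"
      using norm_triangle_ineq2[of \<tau> "f (y n)"] \<tau> by (simp add: norm_minus_commute)
    then have "(1 - cmod (f (y n))) * (1 + cmod (f (y n))) \<le> cmod (f (y n) - \<tau>) * (1 + cmod (f (y n)))"
      by (intro mult_right_mono) auto
    also have "\<dots> = c n * (1 - (cmod (y n))\<^sup>2)"
    proof -
      have "1 - (cmod (y n))\<^sup>2 = cmod (y n - \<tau>) * (1 + cmod (y n))"
        by (simp add: normy yd power2_eq_square algebra_simps)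
      moreover have "cmod (y n - \<tau>) \<noteq> 0" "1 + cmod (y n) \<noteq> 0"
        using yd[of n] e[of n] by (auto simp: normy)
      ultimately show ?thesis
        unfolding c_def norm_divide \<open>1 - (cmod (y n))\<^sup>2 = _\<close> by (simp del: norm_eq_zero)
    qed
    finally show ?thesis by (simp add: power2_eq_square algebra_simps)
  qed
  show ?thesis
  proof (rule that[OF \<tau> d])
    fix z assume z: "z \<in> unit_disk"
    show "(cmod (\<tau> - \<phi> 1 z))\<^sup>2 * (1 - (cmod z)\<^sup>2) \<le> d * ((cmod (\<tau> - z))\<^sup>2 * (1 - (cmod (\<phi> 1 z))\<^sup>2))"
      using Julia_lemma[OF holf fim y ylim flim \<tau> \<tau> cq clim z] by (simp add: f_def)
  qed
qed

section \<open>Hyperbolic Koenigs domains lie in strips\<close>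

text \<open>
  Schwarz's lemma for \<open>G\<close> followed by the Cayley transform that sends \<open>G 0\<close> to the origin. This is
  Harnack's inequality for the positive harmonic function \<open>Re G\<close>.
\<close>

lemma Harnack_half_plane:
  assumes holG: "G holomorphic_on unit_disk" and pos: "\<And>z. z \<in> unit_disk \<Longrightarrow> 0 < Re (G z)"
    and z: "z \<in> unit_disk"
  shows "(1 - cmod z) * Re (G z) \<le> (1 + cmod z) * Re (G 0)"
proof -
  define A where "A = G 0"
  have A: "0 < Re A" using pos[of 0] by (simp add: A_def)
  have nz: "G \<zeta> + cnj A \<noteq> 0" if "\<zeta> \<in> unit_disk" for \<zeta>
  proof -
    have "0 < Re (G \<zeta> + cnj A)" using A pos[OF that] by simp
    then show ?thesis by (metis less_irrefl zero_complex.sel(1))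
  qed
  define g where "g \<zeta> = (G \<zeta> - A) / (G \<zeta> + cnj A)" for \<zeta>
  have diff_sq: "(cmod (B + cnj A))\<^sup>2 - (cmod (B - A))\<^sup>2 = 4 * Re A * Re B" for B
    unfolding cmod_power2 by (simp add: power2_eq_square algebra_simps)
  have "g holomorphic_on unit_disk"
    unfolding g_def using nz by (intro holomorphic_intros holG) auto
  moreover have "g 0 = 0" by (simp add: g_def A_def)
  moreover have "cmod (g \<zeta>) < 1" if "cmod \<zeta> < 1" for \<zeta>
  proof -
    have d: "\<zeta> \<in> unit_disk" using that by simp
    have "0 < Re A * Re (G \<zeta>)" using A pos[OF d] by simp
    then have "(cmod (G \<zeta> - A))\<^sup>2 < (cmod (G \<zeta> + cnj A))\<^sup>2"
      using diff_sq[of "G \<zeta>"] by linarith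
    then have "cmod (G \<zeta> - A) < cmod (G \<zeta> + cnj A)"
      by (rule power2_less_imp_less) simp
    then show ?thesis using nz[OF d] by (simp add: g_def norm_divide)
  qed
  ultimately have "cmod (g z) \<le> cmod z"
    using Schwarz_Lemma(1)[of g z] z by auto
  then have "cmod (G z - A) \<le> cmod z * cmod (G z + cnj A)"
    using nz[OF z] by (simp add: g_def norm_divide divide_simps)
  then have "(cmod (G z - A))\<^sup>2 \<le> (cmod z)\<^sup>2 * (cmod (G z + cnj A))\<^sup>2"
    using power_mono[of "cmod (G z - A)" "cmod z * cmod (G z + cnj A)" 2] by (simp add: power_mult_distrib)
  then have *: "(Re (G z) - Re A)\<^sup>2 + (Im (G z) - Im A)\<^sup>2
      \<le> (cmod z)\<^sup>2 * (Re (G z) + Re A)\<^sup>2 + (cmod z)\<^sup>2 * (Im (G z) - Im A)\<^sup>2"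
    by (simp add: cmod_power2 distrib_left)
  have "(cmod z)\<^sup>2 * (Im (G z) - Im A)\<^sup>2 \<le> (Im (G z) - Im A)\<^sup>2"
    using z by (intro mult_left_le_one_le) (auto simp: abs_square_le_1 less_imp_le)
  with * have "(Re (G z) - Re A)\<^sup>2 \<le> (cmod z * (Re (G z) + Re A))\<^sup>2"
    by (simp add: power_mult_distrib)
  then have "Re (G z) - Re A \<le> cmod z * (Re (G z) + Re A)"
    by (rule power2_le_imp_le) (use A pos[OF z] in auto)
  then show ?thesis by (simp add: A_def algebra_simps)
qed

text \<open>
  A path from \<open>w1\<close> to \<open>w2\<close> meets every height between \<open>Im w1\<close> and \<open>Im w2\<close> at a bounded abscissa, so
  by invariance under translation to the right a half-strip of height at least \<open>2 R\<close> lies in the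
  domain.
\<close>

lemma translation_invariant_domain_contains_ball:
  fixes \<Omega> :: "complex set"
  assumes "open \<Omega>" "connected \<Omega>"
    and shift: "\<And>w t. w \<in> \<Omega> \<Longrightarrow> 0 \<le> t \<Longrightarrow> w + of_real t \<in> \<Omega>"
    and wide: "w1 \<in> \<Omega>" "w2 \<in> \<Omega>" "Im w1 + 2 * R \<le> Im w2"
  shows "\<exists>p. ball p R \<subseteq> \<Omega>"
proof -
  have "path_connected \<Omega>"
    using assms connected_open_path_connected by blast
  then obtain \<gamma> where \<gamma>: "path \<gamma>" "path_image \<gamma> \<subseteq> \<Omega>" "pathstart \<gamma> = w1" "pathfinish \<gamma> = w2"
    using wide unfolding path_connected_def by meson
  have "bounded (path_image \<gamma>)"
    using \<gamma> by (simp add: bounded_path_image)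
  then obtain X where X: "\<And>w. w \<in> path_image \<gamma> \<Longrightarrow> cmod w \<le> X"
    by (meson bounded_iff)
  have conn: "connected (Im ` path_image \<gamma>)"
    using \<gamma>(1) by (intro connected_continuous_image connected_path_image continuous_intros)
  have ends: "Im w1 \<in> Im ` path_image \<gamma>" "Im w2 \<in> Im ` path_image \<gamma>"
    using pathstart_in_path_image[of \<gamma>] pathfinish_in_path_image[of \<gamma>] \<gamma> by auto
  have far: "w \<in> \<Omega>" if "Im w1 \<le> Im w" "Im w \<le> Im w2" "X \<le> Re w" for w
  proof -
    have "Im w \<in> Im ` path_image \<gamma>"
      using connectedD_interval[OF conn ends] that by blast
    then obtain v where v: "v \<in> path_image \<gamma>" "Im v = Im w" by force
    have "Re v \<le> Re w"
      using X[OF v(1)] complex_Re_le_cmod[of v] that by linarith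
    then have "v + of_real (Re w - Re v) \<in> \<Omega>"
      using \<gamma>(2) v by (intro shift) auto
    also have "v + of_real (Re w - Re v) = w"
      using v by (simp add: complex_eq_iff)
    finally show ?thesis .
  qed
  have "ball (Complex (X + R) ((Im w1 + Im w2) / 2)) R \<subseteq> \<Omega>"
  proof
    fix w assume "w \<in> ball (Complex (X + R) ((Im w1 + Im w2) / 2)) R"
    then have d: "cmod (w - Complex (X + R) ((Im w1 + Im w2) / 2)) < R"
      by (simp add: dist_norm norm_minus_commute)
    have "\<bar>Re w - (X + R)\<bar> < R" "\<bar>Im w - (Im w1 + Im w2) / 2\<bar> < R"
      using abs_Re_le_cmod[of "w - Complex (X + R) ((Im w1 + Im w2) / 2)"]
        abs_Im_le_cmod[of "w - Complex (X + R) ((Im w1 + Im w2) / 2)"] d by auto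
    then show "w \<in> \<Omega>"
      using wide(3) by (intro far) (simp_all only: abs_less_iff field_simps, linarith+)
  qed
  then show ?thesis by blast
qed

lemma koenigs_domain_shift:
  assumes "holomorphic_semigroup \<phi>" "koenigs_function \<phi> h" "w \<in> h ` unit_disk" "0 \<le> t"
  shows "w + of_real t \<in> h ` unit_disk"
proof -
  obtain z where z: "z \<in> unit_disk" "w = h z"
    using assms(3) by blast
  then have "h (\<phi> t z) = w + of_real t" "\<phi> t z \<in> unit_disk"
    using assms by (auto simp: koenigs_function_def holomorphic_semigroup_def image_subset_iff simp del: mem_ball)
  then show ?thesis by (metis imageI)
qed

lemma koenigs_domain_open_connected:
  assumes "koenigs_function \<phi> h"
  shows "open (h ` unit_disk)" "connected (h ` unit_disk)"
  using assms
  by (auto simp: koenigs_function_def intro!: open_mapping_thm3 connected_continuous_image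
      holomorphic_on_imp_continuous_on)

text \<open>
  Let \<open>G = (\<tau> + h\<inverse>) / (\<tau> - h\<inverse>)\<close> on the Koenigs domain. Its real part is the Poisson kernel at \<open>\<tau>\<close>,
  and the Julia inequality says that \<open>Re G\<close> grows at least by the factor \<open>1 / d > 1\<close> when one moves a
  unit step to the right. If the domain were not contained in a strip, it would contain balls of
  every radius \<open>R\<close>, and in such a ball Harnack's inequality allows the factor \<open>(R + 1) / (R - 1)\<close> only,
  which tends to \<open>1\<close>.
\<close>

lemma hyperbolic_koenigs_domain_in_strip:
  assumes hyp: "hyperbolic_semigroup \<phi>" and koenigs: "koenigs_function \<phi> h"
  obtains Y where "\<And>w. w \<in> h ` unit_disk \<Longrightarrow> \<bar>Im w\<bar> \<le> Y"
proof -
  define \<Omega> where "\<Omega> = h ` unit_disk"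
  obtain \<tau> d where \<tau>: "cmod \<tau> = 1" and d: "0 < d" "d < 1"
    and julia: "\<And>z. z \<in> unit_disk \<Longrightarrow>
       (cmod (\<tau> - \<phi> 1 z))\<^sup>2 * (1 - (cmod z)\<^sup>2) \<le> d * ((cmod (\<tau> - z))\<^sup>2 * (1 - (cmod (\<phi> 1 z))\<^sup>2))"
    using hyperbolic_Julia_inequality[OF hyp] by metis
  have sg: "holomorphic_semigroup \<phi>"
    using hyp by (simp add: hyperbolic_semigroup_def non_elliptic_semigroup_def)
  have holh: "h holomorphic_on unit_disk" and injh: "inj_on h unit_disk"
    using koenigs by (auto simp: koenigs_function_def)
  have hshift: "h (\<phi> t z) = h z + of_real t" if "t \<ge> 0" "z \<in> unit_disk" for t z
    using koenigs that by (auto simp: koenigs_function_def)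
  have "open \<Omega>" "connected \<Omega>"
    using koenigs_domain_open_connected[OF koenigs] by (simp_all add: \<Omega>_def)
  have "\<exists>Y. \<forall>w\<in>\<Omega>. \<bar>Im w\<bar> \<le> Y"
  proof (rule ccontr)
    assume "\<not> ?thesis"
    then have unb: "\<exists>w\<in>\<Omega>. Y < \<bar>Im w\<bar>" for Y
      by (meson not_le)
    \<comment> \<open>Large enough for \<open>(R + 1) / (R - 1) < 1 / d\<close>.\<close>
    define R where "R = (2 + 2 * d) / (1 - d)"
    have "R * (1 - d) = 2 + 2 * d"
      using d by (simp add: R_def)
    then have R: "d * (R + 1) < R - 1"
      using d by (simp add: algebra_simps)
    have "R > 1"
      using d by (simp add: R_def field_simps)
    obtain w0 where w0: "w0 \<in> \<Omega>" using unb by blast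
    obtain w where w: "w \<in> \<Omega>" "\<bar>Im w0\<bar> + 2 * R < \<bar>Im w\<bar>" using unb by blast
    have "\<exists>p. ball p R \<subseteq> \<Omega>"
    proof (cases "Im w \<ge> 0")
      case True
      show ?thesis
        by (rule translation_invariant_domain_contains_ball[OF \<open>open \<Omega>\<close> \<open>connected \<Omega>\<close> _ w0 w(1)])
           (use w True koenigs_domain_shift[OF sg koenigs] in \<open>auto simp: \<Omega>_def\<close>)
    next
      case False
      show ?thesis
        by (rule translation_invariant_domain_contains_ball[OF \<open>open \<Omega>\<close> \<open>connected \<Omega>\<close> _ w(1) w0])
           (use w False koenigs_domain_shift[OF sg koenigs] in \<open>auto simp: \<Omega>_def\<close>)
    qed
    then obtain p where p: "ball p R \<subseteq> \<Omega>" by blast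
    obtain F where holF: "F holomorphic_on \<Omega>" and F: "\<And>z. z \<in> unit_disk \<Longrightarrow> F (h z) = z"
      using holomorphic_has_inverse[OF holh open_ball injh] unfolding \<Omega>_def by metis
    have Fim: "F w \<in> unit_disk" if "w \<in> \<Omega>" for w
      using that F by (auto simp: \<Omega>_def)
    have Fshift: "F (w + 1) = \<phi> 1 (F w)" if "w \<in> \<Omega>" for w
    proof -
      from that obtain z where z: "z \<in> unit_disk" "w = h z" unfolding \<Omega>_def by blast
      have "\<phi> 1 z \<in> unit_disk"
        using sg z by (auto simp: holomorphic_semigroup_def image_subset_iff simp del: mem_ball)
      then show ?thesis
        using F[OF \<open>\<phi> 1 z \<in> unit_disk\<close>] F[OF z(1)] hshift[of 1 z] z by simp
    qed
    \<comment> \<open>The Poisson kernel of the disk at \<open>\<tau>\<close>.\<close>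
    define P where "P v = (1 - (cmod v)\<^sup>2) / (cmod (\<tau> - v))\<^sup>2" for v
    have neq: "\<tau> - v \<noteq> 0" if "v \<in> unit_disk" for v
      using that \<tau> by auto
    have Ppos: "0 < P v" if "v \<in> unit_disk" for v
      using that neq[OF that] by (simp add: P_def abs_square_less_1)
    have poisson: "Re ((\<tau> + v) / (\<tau> - v)) = P v" for v
    proof -
      have "(Re \<tau>)\<^sup>2 + (Im \<tau>)\<^sup>2 = 1" using \<tau> by (metis cmod_power2 one_power2)
      then show ?thesis
        unfolding P_def Re_divide cmod_power2 
        by (simp add: power2_eq_square algebra_simps)
    qed
    have Pstep: "P v \<le> d * P (\<phi> 1 v)" if "v \<in> unit_disk" for v
    proof -
      have "\<phi> 1 v \<in> unit_disk"
        using sg that by (auto simp: holomorphic_semigroup_def image_subset_iff simp del: mem_ball)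
      then show ?thesis
        using julia[OF that] neq[OF that] neq[of "\<phi> 1 v"] by (simp add: P_def field_simps)
    qed
    define G where "G \<zeta> = (\<tau> + F (p + of_real R * \<zeta>)) / (\<tau> - F (p + of_real R * \<zeta>))" for \<zeta>
    have inball: "p + of_real R * \<zeta> \<in> \<Omega>" if "\<zeta> \<in> unit_disk" for \<zeta>
      using p \<open>R > 1\<close> that by (auto simp: dist_norm norm_mult intro!: subsetD[OF p])
    have holFR: "(\<lambda>\<zeta>. F (p + of_real R * \<zeta>)) holomorphic_on unit_disk"
      by (rule holomorphic_on_compose_gen[OF _ holF, unfolded o_def])
         (use inball in \<open>auto intro!: holomorphic_intros\<close>)
    have holG: "G holomorphic_on unit_disk"
      unfolding G_def by (intro holomorphic_intros holFR) (use neq Fim inball in blast)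
    have ReG: "Re (G \<zeta>) = P (F (p + of_real R * \<zeta>))" for \<zeta>
      by (simp only: G_def poisson)
    \<comment> \<open>The ball is rescaled to the unit disk; a unit step from its centre becomes the point \<open>1 / R\<close>.\<close>
    define \<zeta> :: complex where "\<zeta> = of_real (1 / R)"
    have n\<zeta>: "cmod \<zeta> = 1 / R" using \<open>R > 1\<close> by (simp add: \<zeta>_def norm_divide)
    have \<zeta>: "\<zeta> \<in> unit_disk" using \<open>R > 1\<close> n\<zeta> by simp
    have pin: "p \<in> \<Omega>" using inball[of 0] by simp
    have G1: "Re (G \<zeta>) = P (\<phi> 1 (F p))" and G0: "Re (G 0) = P (F p)"
      unfolding ReG using \<open>R > 1\<close> Fshift[OF pin] by (simp_all add: \<zeta>_def)
    have "(1 - cmod \<zeta>) * Re (G \<zeta>) \<le> (1 + cmod \<zeta>) * Re (G 0)"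
      by (rule Harnack_half_plane[OF holG _ \<zeta>]) (use ReG Ppos Fim inball in simp)
    then have "R * ((1 - 1 / R) * P (\<phi> 1 (F p))) \<le> R * ((1 + 1 / R) * P (F p))"
      using \<open>R > 1\<close> unfolding n\<zeta> G1 G0 by simp
    then have "(R - 1) * P (\<phi> 1 (F p)) \<le> (R + 1) * P (F p)"
      using \<open>R > 1\<close> by (simp add: mult.assoc[symmetric] right_diff_distrib distrib_left)
    also have "\<dots> \<le> (R + 1) * (d * P (\<phi> 1 (F p)))"
      using \<open>R > 1\<close> Pstep[OF Fim[OF pin]] by (intro mult_left_mono) auto
    finally have "(R - 1) * P (\<phi> 1 (F p)) \<le> (d * (R + 1)) * P (\<phi> 1 (F p))"
      by (simp add: mult_ac)
    moreover have "0 < P (\<phi> 1 (F p))"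
      using Pstep[OF Fim[OF pin]] Ppos[OF Fim[OF pin]] d by (smt (verit) mult_nonneg_nonpos)
    ultimately show False
      using R by simp
  qed
  then show ?thesis using that by (auto simp: \<Omega>_def)
qed

section \<open>Area integrals in the plane\<close>

lemma set_nn_integral_finite_iff_set_integrable:
  fixes f :: "'a \<Rightarrow> real"
  assumes "set_borel_measurable M A f" "\<And>x. x \<in> A \<Longrightarrow> 0 \<le> f x"
  shows "set_integrable M A f \<longleftrightarrow> (\<integral>\<^sup>+x\<in>A. ennreal (f x) \<partial>M) < \<infinity>"
proof -
  have "(\<integral>\<^sup>+x\<in>A. ennreal (f x) \<partial>M) = (\<integral>\<^sup>+x. ennreal (norm (indicator A x *\<^sub>R f x)) \<partial>M)"
    by (intro nn_integral_cong) (use assms(2) in \<open>auto simp: indicator_def\<close>)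
  then show ?thesis
    using assms(1) by (simp add: set_integrable_def set_borel_measurable_def integrable_iff_bounded)
qed

lemma continuous_Complex_pair: "continuous_on UNIV (\<lambda>p. Complex (fst p) (snd p))"
  by (simp add: Complex_eq) (intro continuous_intros)

lemma measurable_Complex_pair: "(\<lambda>p. Complex (fst p) (snd p)) \<in> (lborel \<Otimes>\<^sub>M lborel) \<rightarrow>\<^sub>M borel"
  unfolding lborel_prod using borel_measurable_continuous_onI[OF continuous_Complex_pair] by simp

lemma slice_measurable:
  assumes "open \<Omega>"
  shows "{y. Complex x y \<in> \<Omega>} \<in> sets lborel"
proof -
  have "continuous_on UNIV (Complex x)"
    by (simp add: Complex_eq) (intro continuous_intros)
  then have "open (Complex x -` \<Omega>)" using assms open_vimage by blast
  then show ?thesis by (simp add: vimage_def)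
qed

lemma lborel_complex_eq_distr_pair:
  "(lborel :: complex measure) = distr (lborel \<Otimes>\<^sub>M lborel) borel (\<lambda>p. Complex (fst p) (snd p))"
proof (rule lborel_eqI)
  fix l u :: complex
  assume le: "\<And>b. b \<in> Basis \<Longrightarrow> l \<bullet> b \<le> u \<bullet> b"
  have le': "Re l \<le> Re u" "Im l \<le> Im u"
    using le[of 1] le[of \<i>] by (auto simp: Basis_complex_def)
  have "(\<lambda>p. Complex (fst p) (snd p)) -` box l u = {Re l<..<Re u} \<times> {Im l<..<Im u}"
    by (auto simp: in_box_complex_iff)
  then have "emeasure (distr (lborel \<Otimes>\<^sub>M lborel) borel (\<lambda>p. Complex (fst p) (snd p))) (box l u)
      = emeasure (lborel \<Otimes>\<^sub>M lborel) ({Re l<..<Re u} \<times> {Im l<..<Im u})"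
    by (subst emeasure_distr[OF measurable_Complex_pair]) (auto simp: space_pair_measure)
  also have "\<dots> = ennreal (Re u - Re l) * ennreal (Im u - Im l)"
    using le' by (simp add: lborel.emeasure_pair_measure_Times)
  also have "\<dots> = ennreal (\<Prod>b\<in>Basis. (u - l) \<bullet> b)"
    using le' by (simp add: Basis_complex_def ennreal_mult)
  finally show "emeasure (distr (lborel \<Otimes>\<^sub>M lborel) borel (\<lambda>p. Complex (fst p) (snd p))) (box l u)
      = ennreal (\<Prod>b\<in>Basis. (u - l) \<bullet> b)" .
qed simp

text \<open>
  Coordinates turn a holomorphic map into a map of \<open>real^2\<close>, whose Jacobian is the determinant of a
  matrix.
\<close>

definition complex_of_vec :: "real^2 \<Rightarrow> complex" where
  "complex_of_vec v = Complex (v $ 1) (v $ 2)"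

definition vec_of_complex :: "complex \<Rightarrow> real^2" where
  "vec_of_complex z = vector [Re z, Im z]"

lemma complex_of_vec_inverse [simp]:
  "complex_of_vec (vec_of_complex z) = z" "vec_of_complex (complex_of_vec v) = v"
  by (simp_all add: complex_of_vec_def vec_of_complex_def vec_eq_iff forall_2)

lemma bounded_linear_complex_of_vec: "bounded_linear complex_of_vec"
  by (intro linear_conv_bounded_linear[THEN iffD1] linearI)
     (auto simp: complex_of_vec_def complex_eq_iff)

lemma bounded_linear_vec_of_complex: "bounded_linear vec_of_complex"
  by (intro linear_conv_bounded_linear[THEN iffD1] linearI)
     (auto simp: vec_of_complex_def vec_eq_iff forall_2)

lemma measurable_complex_of_vec: "complex_of_vec \<in> lborel \<rightarrow>\<^sub>M borel"
  using borel_measurable_continuous_onI[OF linear_continuous_on[OF bounded_linear_complex_of_vec]] by simp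

lemma lborel_complex_eq_distr_vec: "(lborel :: complex measure) = distr lborel borel complex_of_vec"
proof (rule lborel_eqI)
  fix l u :: complex
  assume le: "\<And>b. b \<in> Basis \<Longrightarrow> l \<bullet> b \<le> u \<bullet> b"
  have le': "Re l \<le> Re u" "Im l \<le> Im u"
    using le[of 1] le[of \<i>] by (auto simp: Basis_complex_def)
  have basis: "(Basis :: (real^2) set) = {axis 1 1, axis 2 1}"
    by (auto simp: Basis_vec_def UNIV_2)
  have ne: "axis 1 1 \<noteq> (axis 2 1 :: real^2)" by (simp add: axis_eq_axis)
  have "complex_of_vec -` box l u = box (vec_of_complex l) (vec_of_complex u)"
    by (auto simp: in_box_complex_iff mem_box basis inner_axis complex_of_vec_def vec_of_complex_def)
  then have "emeasure (distr lborel borel complex_of_vec) (box l u)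
      = emeasure lborel (box (vec_of_complex l) (vec_of_complex u))"
    by (subst emeasure_distr[OF measurable_complex_of_vec]) auto
  also have "\<dots> = ennreal (\<Prod>b\<in>Basis. (vec_of_complex u - vec_of_complex l) \<bullet> b)"
    by (rule emeasure_lborel_box) (use le' in \<open>auto simp: basis inner_axis vec_of_complex_def\<close>)
  also have "\<dots> = ennreal (\<Prod>b\<in>Basis. (u - l) \<bullet> b)"
    using ne by (simp add: Basis_complex_def basis inner_axis vec_of_complex_def)
  finally show "emeasure (distr lborel borel complex_of_vec) (box l u) = ennreal (\<Prod>b\<in>Basis. (u - l) \<bullet> b)" .
qed simp

lemma set_integrable_complex_iff_vec:
  fixes f :: "complex \<Rightarrow> real"
  assumes "set_borel_measurable borel A f"
  shows "set_integrable lborel A f \<longleftrightarrow> (\<lambda>v. f (complex_of_vec v)) absolutely_integrable_on (complex_of_vec -` A)"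
proof -
  have f: "(\<lambda>z. indicator A z *\<^sub>R f z) \<in> borel_measurable borel"
    using assms by (simp add: set_borel_measurable_def)
  have fT: "(\<lambda>v. indicator (complex_of_vec -` A) v *\<^sub>R f (complex_of_vec v)) \<in> borel_measurable lborel"
    using measurable_compose[OF measurable_complex_of_vec f] by (simp add: indicator_def)
  have "set_integrable lborel A f \<longleftrightarrow> integrable (distr lborel borel complex_of_vec) (\<lambda>z. indicator A z *\<^sub>R f z)"
    unfolding set_integrable_def by (subst lborel_complex_eq_distr_vec) simp
  also have "\<dots> \<longleftrightarrow> integrable lborel (\<lambda>v. indicator A (complex_of_vec v) *\<^sub>R f (complex_of_vec v))"
    by (rule integrable_distr_eq[OF measurable_complex_of_vec f])
  also have "\<dots> \<longleftrightarrow> integrable lebesgue (\<lambda>v. indicator (complex_of_vec -` A) v *\<^sub>R f (complex_of_vec v))"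
    by (subst integrable_completion[OF fT]) (simp add: indicator_def)
  finally show ?thesis by (simp add: set_integrable_def)
qed

text \<open>
  The Jacobian of a holomorphic map is \<open>|h'|\<^sup>2\<close>, by the Cauchy--Riemann equations.
\<close>

lemma set_integrable_conformal_change_of_variables:
  fixes g :: "complex \<Rightarrow> real"
  assumes S: "open S" and holh: "h holomorphic_on S" and injh: "inj_on h S"
    and contg: "continuous_on UNIV g"
  shows "set_integrable lborel S (\<lambda>z. (cmod (deriv h z))\<^sup>2 * g (h z)) \<longleftrightarrow> set_integrable lborel (h ` S) g"
proof -
  have openh: "open (h ` S)"
    using S holh injh by (simp add: open_mapping_thm3)
  have "continuous_on S (\<lambda>z. (cmod (deriv h z))\<^sup>2 * g (h z))"
    by (intro continuous_intros holomorphic_on_imp_continuous_on[OF holomorphic_deriv[OF holh S]]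
        continuous_on_compose2[OF contg holomorphic_on_imp_continuous_on[OF holh]]) auto
  then have m1: "set_borel_measurable borel S (\<lambda>z. (cmod (deriv h z))\<^sup>2 * g (h z))"
    using S unfolding set_borel_measurable_def by (intro borel_measurable_continuous_on_indicator) auto
  have m2: "set_borel_measurable borel (h ` S) g"
    using openh continuous_on_subset[OF contg] unfolding set_borel_measurable_def
    by (intro borel_measurable_continuous_on_indicator) auto
  define V where "V = complex_of_vec -` S"
  define H where "H = vec_of_complex \<circ> h \<circ> complex_of_vec"
  define H' where "H' v = vec_of_complex \<circ> (\<lambda>w. deriv h (complex_of_vec v) * w) \<circ> complex_of_vec" for v
  have "open V"
    unfolding V_def by (rule open_vimage[OF S linear_continuous_on[OF bounded_linear_complex_of_vec]])
  have der: "(H has_derivative H' v) (at v within V)" if "v \<in> V" for v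
  proof -
    have "(h has_field_derivative deriv h (complex_of_vec v)) (at (complex_of_vec v))"
      using that holh S by (simp add: V_def holomorphic_derivI)
    then have "(h has_derivative (\<lambda>w. deriv h (complex_of_vec v) * w)) (at (complex_of_vec v))"
      by (simp add: has_field_derivative_def)
    then have "(H has_derivative H' v) (at v)"
      unfolding H_def H'_def
      by (intro diff_chain_at bounded_linear_imp_has_derivative bounded_linear_complex_of_vec
          bounded_linear_vec_of_complex) simp
    then show ?thesis by (rule has_derivative_at_withinI)
  qed
  have inj: "inj_on H V"
  proof (rule inj_onI)
    fix v w assume *: "v \<in> V" "w \<in> V" "H v = H w"
    then have "h (complex_of_vec v) = h (complex_of_vec w)"
      unfolding H_def o_def by (metis complex_of_vec_inverse(1))
    then have "complex_of_vec v = complex_of_vec w"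
      using * injh by (auto simp: V_def dest: inj_onD)
    then show "v = w" by (metis complex_of_vec_inverse(2))
  qed
  have det: "\<bar>det (matrix (H' v))\<bar> = (cmod (deriv h (complex_of_vec v)))\<^sup>2" for v
    unfolding cmod_power2
    by (simp add: det_2 matrix_def H'_def complex_of_vec_def vec_of_complex_def axis_def power2_eq_square)
  have image: "H ` V = complex_of_vec -` (h ` S)"
  proof
    show "H ` V \<subseteq> complex_of_vec -` (h ` S)" by (auto simp: H_def V_def)
    show "complex_of_vec -` (h ` S) \<subseteq> H ` V"
    proof
      fix v assume "v \<in> complex_of_vec -` (h ` S)"
      then obtain z where z: "z \<in> S" "complex_of_vec v = h z" by auto
      then have "v = H (vec_of_complex z)"
        unfolding H_def o_def by (metis complex_of_vec_inverse)
      then show "v \<in> H ` V" using z by (auto simp: V_def)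
    qed
  qed
  have HT: "complex_of_vec (H v) = h (complex_of_vec v)" for v
    by (simp add: H_def)
  have "set_integrable lborel S (\<lambda>z. (cmod (deriv h z))\<^sup>2 * g (h z)) \<longleftrightarrow>
      (\<lambda>v. \<bar>det (matrix (H' v))\<bar> *\<^sub>R (vec (g (complex_of_vec (H v))) :: real^1)) absolutely_integrable_on V"
    unfolding set_integrable_complex_iff_vec[OF m1] absolutely_integrable_on_1_iff det HT V_def by simp
  also have "\<dots> \<longleftrightarrow> (\<lambda>v. vec (g (complex_of_vec v)) :: real^1) absolutely_integrable_on (H ` V)"
    by (rule absolutely_integrable_change_of_variables[OF _ der inj, symmetric]) (simp add: \<open>open V\<close>)
  also have "\<dots> \<longleftrightarrow> set_integrable lborel (h ` S) g"
    unfolding set_integrable_complex_iff_vec[OF m2] absolutely_integrable_on_1_iff image by simp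
  finally show ?thesis .
qed

lemma measurable_slice_length:
  assumes "open \<Omega>"
  shows "slice_length \<Omega> \<in> borel_measurable lborel"
proof -
  have "open ((\<lambda>p. Complex (fst p) (snd p)) -` \<Omega>)"
    using assms continuous_Complex_pair open_vimage by blast
  then have "(\<lambda>p. Complex (fst p) (snd p)) -` \<Omega> \<in> sets (lborel \<Otimes>\<^sub>M lborel)"
    unfolding lborel_prod by simp
  then have "(\<lambda>x. emeasure lborel (Pair x -` ((\<lambda>p. Complex (fst p) (snd p)) -` \<Omega>))) \<in> borel_measurable lborel"
    by (rule lborel.measurable_emeasure_Pair)
  then show ?thesis
    by (simp add: slice_length_def[abs_def] vimage_def)
qed

text \<open>
  Tonelli's theorem: integrating out the imaginary part leaves the length of the vertical slice.
\<close>

lemma nn_integral_over_slices: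
  assumes \<Omega>: "open \<Omega>" and k: "k \<in> borel_measurable borel"
  shows "(\<integral>\<^sup>+w\<in>\<Omega>. k (Re w) \<partial>lborel) = (\<integral>\<^sup>+x. k x * slice_length \<Omega> x \<partial>lborel)"
proof -
  have [measurable]: "Re \<in> borel_measurable borel"
    by (intro borel_measurable_continuous_onI continuous_intros)
  have [measurable]: "\<Omega> \<in> sets borel" using \<Omega> by simp
  note [measurable] = k
  have mk: "(\<lambda>w. k (Re w) * indicator \<Omega> w) \<in> borel_measurable borel" by measurable
  have "(\<integral>\<^sup>+w\<in>\<Omega>. k (Re w) \<partial>lborel)
      = (\<integral>\<^sup>+p. k (Re (Complex (fst p) (snd p))) * indicator \<Omega> (Complex (fst p) (snd p)) \<partial>(lborel \<Otimes>\<^sub>M lborel))"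
    by (subst lborel_complex_eq_distr_pair) (rule nn_integral_distr[OF measurable_Complex_pair], use mk in simp)
  also have "\<dots> = (\<integral>\<^sup>+x. (\<integral>\<^sup>+y. k x * indicator \<Omega> (Complex x y) \<partial>lborel) \<partial>lborel)"
    using lborel.nn_integral_fst[OF measurable_compose[OF measurable_Complex_pair mk]] by simp
  also have "\<dots> = (\<integral>\<^sup>+x. k x * slice_length \<Omega> x \<partial>lborel)"
  proof (rule nn_integral_cong)
    fix x
    have "(\<integral>\<^sup>+y. k x * indicator \<Omega> (Complex x y) \<partial>lborel) = (\<integral>\<^sup>+y. k x * indicator {y. Complex x y \<in> \<Omega>} y \<partial>lborel)"
      by (intro nn_integral_cong) (auto simp: indicator_def)
    also have "\<dots> = k x * slice_length \<Omega> x"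
      using slice_measurable[OF \<Omega>, of x] by (subst nn_integral_cmult_indicator) (auto simp: slice_length_def)
    finally show "(\<integral>\<^sup>+y. k x * indicator \<Omega> (Complex x y) \<partial>lborel) = k x * slice_length \<Omega> x" .
  qed
  finally show ?thesis .
qed

section \<open>The Dirichlet space and the eigenfunctions of the generator\<close>

lemma deriv_cong_on_disk:
  assumes "\<And>z. z \<in> unit_disk \<Longrightarrow> f z = g z" "z \<in> unit_disk"
  shows "deriv f z = deriv g z"
proof (rule deriv_cong_ev)
  show "\<forall>\<^sub>F w in nhds z. f w = g w"
    using eventually_nhds_in_open[OF open_ball assms(2)] by eventually_elim (use assms(1) in blast)
qed simp

lemma dirichlet_spaceD:
  assumes "f \<in> dirichlet_space"
  shows "f holomorphic_on unit_disk" "set_integrable lborel unit_disk (\<lambda>z. (cmod (deriv f z))\<^sup>2)"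
  using assms unfolding dirichlet_space_def by blast+

text \<open>
  The disk is open, so the derivatives at its points depend on the restriction to the disk alone.
\<close>

lemma dirichlet_space_cong:
  assumes "\<And>z. z \<in> unit_disk \<Longrightarrow> f z = g z"
  shows "f \<in> dirichlet_space \<longleftrightarrow> g \<in> dirichlet_space"
proof -
  have "f holomorphic_on unit_disk \<longleftrightarrow> g holomorphic_on unit_disk"
    using assms by (intro holomorphic_cong) auto
  moreover have "set_integrable lborel unit_disk (\<lambda>z. (cmod (deriv f z))\<^sup>2) \<longleftrightarrow>
      set_integrable lborel unit_disk (\<lambda>z. (cmod (deriv g z))\<^sup>2)"
    using deriv_cong_on_disk[of f g, OF assms] by (intro set_integrable_cong refl) metis
  ultimately show ?thesis by (simp add: dirichlet_space_def)
qed

lemma dirichlet_norm_cong: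
  assumes "\<And>z. z \<in> unit_disk \<Longrightarrow> f z = g z"
  shows "dirichlet_norm f = dirichlet_norm g"
proof -
  have "(LINT z:unit_disk|lborel. (cmod (deriv f z))\<^sup>2) = (LINT z:unit_disk|lborel. (cmod (deriv g z))\<^sup>2)"
    using deriv_cong_on_disk[of f g, OF assms] by (intro set_lebesgue_integral_cong allI impI) (simp, metis)
  then show ?thesis using assms[of 0] by (simp add: dirichlet_norm_def)
qed

lemma deriv_cmult_on_disk:
  assumes "f holomorphic_on unit_disk" "z \<in> unit_disk"
  shows "deriv (\<lambda>w. c * f w) z = c * deriv f z"
  by (rule deriv_cmult[OF holomorphic_on_imp_differentiable_at[OF assms(1) open_ball assms(2)]])

lemma dirichlet_space_cmult:
  assumes "f \<in> dirichlet_space"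
  shows "(\<lambda>z. c * f z) \<in> dirichlet_space"
proof -
  note f = dirichlet_spaceD[OF assms]
  have "set_integrable lborel unit_disk (\<lambda>z. (cmod c)\<^sup>2 * (cmod (deriv f z))\<^sup>2)"
    using f by (intro set_integrable_mult_right)
  also have "?this \<longleftrightarrow> set_integrable lborel unit_disk (\<lambda>z. (cmod (deriv (\<lambda>z. c * f z) z))\<^sup>2)"
    by (intro set_integrable_cong refl) (simp only: deriv_cmult_on_disk[OF f(1)] norm_mult power_mult_distrib)
  finally show ?thesis
    using holomorphic_on_mult[OF holomorphic_on_const f(1)] by (simp add: dirichlet_space_def)
qed

lemma dirichlet_norm_cmult:
  assumes "f holomorphic_on unit_disk"
  shows "dirichlet_norm (\<lambda>z. c * f z) = cmod c * dirichlet_norm f"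
proof -
  have "(LINT z:unit_disk|lborel. (cmod (deriv (\<lambda>z. c * f z) z))\<^sup>2)
      = (LINT z:unit_disk|lborel. (cmod c)\<^sup>2 * (cmod (deriv f z))\<^sup>2)"
    using deriv_cmult_on_disk[OF assms, of _ c]
    by (intro set_lebesgue_integral_cong allI impI) (simp, metis norm_mult power_mult_distrib)
  then have "dirichlet_norm (\<lambda>z. c * f z) = sqrt ((cmod c)\<^sup>2 *
      ((cmod (f 0))\<^sup>2 + (1 / pi) * (LINT z:unit_disk|lborel. (cmod (deriv f z))\<^sup>2)))"
    by (simp add: dirichlet_norm_def norm_mult power_mult_distrib distrib_left)
  then show ?thesis
    by (simp add: real_sqrt_mult dirichlet_norm_def)
qed

lemma dirichlet_space_diff:
  assumes "f \<in> dirichlet_space" "g \<in> dirichlet_space"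
  shows "(\<lambda>z. f z - g z) \<in> dirichlet_space"
proof -
  note f = dirichlet_spaceD[OF assms(1)] and g = dirichlet_spaceD[OF assms(2)]
  have hol: "(\<lambda>z. f z - g z) holomorphic_on unit_disk"
    by (rule holomorphic_on_diff[OF f(1) g(1)])
  have "continuous_on unit_disk (\<lambda>z. (cmod (deriv (\<lambda>z. f z - g z) z))\<^sup>2)"
    by (intro continuous_intros holomorphic_on_imp_continuous_on[OF holomorphic_deriv[OF hol open_ball]])
  then have "(\<lambda>z. indicator unit_disk z *\<^sub>R (cmod (deriv (\<lambda>z. f z - g z) z))\<^sup>2) \<in> borel_measurable borel"
    by (intro borel_measurable_continuous_on_indicator) auto
  then have meas: "set_borel_measurable lborel unit_disk (\<lambda>z. (cmod (deriv (\<lambda>z. f z - g z) z))\<^sup>2)"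
    by (simp add: set_borel_measurable_def)
  have der: "deriv (\<lambda>z. f z - g z) z = deriv f z - deriv g z" if "z \<in> unit_disk" for z
    using f(1) g(1) that
    by (intro deriv_diff holomorphic_on_imp_differentiable_at[OF _ open_ball])
  have sq: "(cmod (a - b))\<^sup>2 \<le> 2 * (cmod a)\<^sup>2 + 2 * (cmod b)\<^sup>2" for a b :: complex
  proof -
    have "(cmod (a - b))\<^sup>2 \<le> (cmod a + cmod b)\<^sup>2"
      by (intro power_mono norm_triangle_ineq4) simp
    also have "\<dots> \<le> 2 * (cmod a)\<^sup>2 + 2 * (cmod b)\<^sup>2"
      using sum_squares_bound[of "cmod a" "cmod b"] by (simp add: power2_sum)
    finally show ?thesis .
  qed
  have "set_integrable lborel unit_disk (\<lambda>z. 2 * (cmod (deriv f z))\<^sup>2 + 2 * (cmod (deriv g z))\<^sup>2)"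
    by (intro set_integral_add set_integrable_mult_right f g)
  then have "set_integrable lborel unit_disk (\<lambda>z. (cmod (deriv (\<lambda>z. f z - g z) z))\<^sup>2)"
    by (rule set_integrable_bound[OF _ meas]) (intro AE_I2 impI, simp only: der, simp add: sq)
  then show ?thesis using hol by (simp add: dirichlet_space_def)
qed

lemma norm_at_zero_le_dirichlet_norm: "cmod (f 0) \<le> dirichlet_norm f"
proof -
  have "0 \<le> (LINT z:unit_disk|lborel. (cmod (deriv f z))\<^sup>2)"
    unfolding set_lebesgue_integral_def by (intro Bochner_Integration.integral_nonneg) auto
  then show ?thesis
    unfolding dirichlet_norm_def by (intro real_le_rsqrt) simp
qed

lemma dirichlet_integral_le_dirichlet_norm:
  assumes "f \<in> dirichlet_space"
  shows "(\<integral>\<^sup>+z\<in>unit_disk. ennreal ((cmod (deriv f z))\<^sup>2) \<partial>lborel) \<le> ennreal (pi * (dirichlet_norm f)\<^sup>2)"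
proof -
  let ?I = "LINT z:unit_disk|lborel. (cmod (deriv f z))\<^sup>2"
  have int: "integrable lborel (\<lambda>z. indicator unit_disk z *\<^sub>R (cmod (deriv f z))\<^sup>2)"
    using assms by (simp add: dirichlet_space_def set_integrable_def)
  have I0: "0 \<le> ?I" unfolding set_lebesgue_integral_def by (intro Bochner_Integration.integral_nonneg) auto
  have "(\<integral>\<^sup>+z\<in>unit_disk. ennreal ((cmod (deriv f z))\<^sup>2) \<partial>lborel)
      = (\<integral>\<^sup>+z. ennreal (indicator unit_disk z *\<^sub>R (cmod (deriv f z))\<^sup>2) \<partial>lborel)"
    by (intro nn_integral_cong) (auto simp: indicator_def)
  also have "\<dots> = ennreal ?I"
    using nn_integral_eq_integral[OF int] by (simp add: set_lebesgue_integral_def)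
  also have "\<dots> \<le> ennreal (pi * (dirichlet_norm f)\<^sup>2)"
    using I0 by (intro ennreal_leI) (simp add: dirichlet_norm_def distrib_left)
  finally show ?thesis .
qed

lemma continuous_null_integral_imp_zero:
  fixes q :: "'a::euclidean_space \<Rightarrow> real"
  assumes S: "open S" and cont: "continuous_on S q" and nonneg: "\<And>x. x \<in> S \<Longrightarrow> 0 \<le> q x"
    and null: "(\<integral>\<^sup>+x\<in>S. ennreal (q x) \<partial>lborel) = 0" and x: "x \<in> S"
  shows "q x = 0"
proof (rule ccontr)
  assume "q x \<noteq> 0"
  define U where "U = S \<inter> q -` {0<..}"
  have "open U"
    unfolding U_def using S cont by (intro continuous_open_preimage) auto
  have "x \<in> U" using \<open>q x \<noteq> 0\<close> nonneg[OF x] x by (auto simp: U_def)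
  have "(\<lambda>x. indicator S x *\<^sub>R q x) \<in> borel_measurable borel"
    using S cont by (intro borel_measurable_continuous_on_indicator) auto
  then have "(\<lambda>x. ennreal (indicator S x *\<^sub>R q x)) \<in> borel_measurable lborel"
    by simp
  also have "(\<lambda>x. ennreal (indicator S x *\<^sub>R q x)) = (\<lambda>x. ennreal (q x) * indicator S x)"
    by (auto simp: indicator_def)
  finally have "AE x in lborel. ennreal (q x) * indicator S x = 0"
    using null by (simp add: nn_integral_0_iff_AE)
  then have "AE x in lborel. x \<notin> U"
    by eventually_elim (auto simp: U_def ennreal_eq_0_iff)
  then have "U \<in> null_sets lborel"
    using \<open>open U\<close> by (subst AE_iff_null_sets) auto
  then have "negligible U"
    by (simp add: negligible_iff_null_sets null_sets_completionI)
  then show False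
    using open_not_negligible \<open>open U\<close> \<open>x \<in> U\<close> by blast
qed

lemma difference_quotient_LIMSEQ:
  assumes u: "u holomorphic_on \<Omega>" "open \<Omega>" "w \<in> \<Omega>"
  shows "(\<lambda>n. (u (w + of_real (inverse (real (Suc n)))) - u w) / of_real (inverse (real (Suc n)))) \<longlonglongrightarrow> deriv u w"
proof -
  have "(u has_field_derivative deriv u w) (at w)"
    using u holomorphic_derivI by blast
  then have "((\<lambda>k. (u (w + k) - u w) / k) \<longlongrightarrow> deriv u w) (at 0)"
    by (simp add: DERIV_def)
  moreover have "filterlim (\<lambda>n. complex_of_real (inverse (real (Suc n)))) (at 0) sequentially"
    unfolding filterlim_at
    using tendsto_of_real[OF LIMSEQ_inverse_real_of_nat, where 'a = complex] by (simp del: of_nat_Suc)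
  ultimately show ?thesis
    by (rule filterlim_compose)
qed

text \<open>
  With \<open>u = f \<circ> h\<inverse>\<close>, the composition operators become translations, so \<open>u\<close> should satisfy
  \<open>u' = \<mu> u\<close> on the Koenigs domain. The error \<open>E n\<close> of the difference quotient at time \<open>1 / (n + 1)\<close>
  tends to zero in the Dirichlet norm. Its value at the origin therefore tends to zero, which gives
  \<open>u' = \<mu> u\<close> at the point \<open>h 0\<close>. Its derivatives converge pointwise, and by Fatou's lemma their limit
  has vanishing square integral; this gives \<open>u'' = \<mu> u'\<close> everywhere. Hence \<open>u' - \<mu> u\<close> is constant,
  and the constant is zero.
\<close>

lemma generator_eigenfunction:
  assumes sg: "holomorphic_semigroup \<phi>" and koenigs: "koenigs_function \<phi> h"
    and gen: "dirichlet_generator \<phi> f (\<lambda>z. \<mu> * f z)"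
  shows "\<exists>c. \<forall>z\<in>unit_disk. f z = c * exp (\<mu> * h z)"
proof -
  define \<Omega> where "\<Omega> = h ` unit_disk"
  have holh: "h holomorphic_on unit_disk" and injh: "inj_on h unit_disk"
    using koenigs by (auto simp: koenigs_function_def)
  have hshift: "h (\<phi> t z) = h z + of_real t" if "t \<ge> 0" "z \<in> unit_disk" for t z
    using koenigs that by (auto simp: koenigs_function_def)
  have \<phi>in: "\<phi> t z \<in> unit_disk" if "t \<ge> 0" "z \<in> unit_disk" for t z
    using sg that by (auto simp: holomorphic_semigroup_def image_subset_iff simp del: mem_ball)
  have open\<Omega>: "open \<Omega>" and conn\<Omega>: "connected \<Omega>"
    using holh injh unfolding \<Omega>_def
    by (auto intro!: open_mapping_thm3 connected_continuous_image holomorphic_on_imp_continuous_on)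
  obtain F where holF: "F holomorphic_on \<Omega>" and F: "\<And>z. z \<in> unit_disk \<Longrightarrow> F (h z) = z"
    and dF: "\<And>z. z \<in> unit_disk \<Longrightarrow> deriv h z * deriv F (h z) = 1"
    using holomorphic_has_inverse[OF holh open_ball injh] unfolding \<Omega>_def by metis
  have fD: "f \<in> dirichlet_space" and \<mu>fD: "(\<lambda>z. \<mu> * f z) \<in> dirichlet_space"
    using gen by (auto simp: dirichlet_generator_def dirichlet_tendsto_def)
  have holf: "f holomorphic_on unit_disk"
    using fD by (simp add: dirichlet_space_def)
  define u where "u = f \<circ> F"
  have holu: "u holomorphic_on \<Omega>"
    unfolding u_def by (rule holomorphic_on_compose_gen[OF holF holf]) (use F in \<open>auto simp: \<Omega>_def\<close>)
  have holu': "deriv u holomorphic_on \<Omega>" using holu open\<Omega> by (rule holomorphic_deriv)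
  have uh: "u (h z) = f z" if "z \<in> unit_disk" for z
    using F[OF that] by (simp add: u_def)
  have h\<Omega>: "h z \<in> \<Omega>" if "z \<in> unit_disk" for z using that by (auto simp: \<Omega>_def)
  have shift: "h z + of_real t \<in> \<Omega>" if "t \<ge> 0" "z \<in> unit_disk" for t z
    using h\<Omega>[OF \<phi>in[OF that]] hshift[OF that] by simp
  have f\<phi>: "f (\<phi> t z) = u (h z + of_real t)" if "t \<ge> 0" "z \<in> unit_disk" for t z
    using uh[OF \<phi>in[OF that]] hshift[OF that] by simp
  define s where "s n = inverse (real (Suc n))" for n
  have s: "s n > 0" for n by (simp add: s_def)
  have slim: "filterlim s (at_right 0) sequentially"
    unfolding filterlim_at s_def using LIMSEQ_inverse_real_of_nat by (simp del: of_nat_Suc)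
  define E where "E n z = (composition_op \<phi> (s n) f z - f z) / of_real (s n) - \<mu> * f z" for n z
  have "\<forall>\<^sub>F t in at_right 0. (\<lambda>z. (composition_op \<phi> t f z - f z) / of_real t) \<in> dirichlet_space"
    using gen by (auto simp: dirichlet_generator_def dirichlet_tendsto_def)
  then have "\<forall>\<^sub>F n in sequentially. (\<lambda>z. (composition_op \<phi> (s n) f z - f z) / of_real (s n)) \<in> dirichlet_space"
    using slim by (rule eventually_compose_filterlim)
  then have ED: "\<forall>\<^sub>F n in sequentially. E n \<in> dirichlet_space"
    by eventually_elim (use dirichlet_space_diff[OF _ \<mu>fD] in \<open>simp add: E_def[abs_def]\<close>)
  have "((\<lambda>t. dirichlet_norm (\<lambda>z. (composition_op \<phi> t f z - f z) / of_real t - \<mu> * f z)) \<longlongrightarrow> 0) (at_right 0)"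
    using gen by (auto simp: dirichlet_generator_def dirichlet_tendsto_def)
  then have Elim: "(\<lambda>n. dirichlet_norm (E n)) \<longlonglongrightarrow> 0"
    unfolding E_def[abs_def] by (rule filterlim_compose[OF _ slim])
  have Eeq: "E n z = (u (h z + of_real (s n)) - u (h z)) / of_real (s n) - \<mu> * u (h z)"
    if "z \<in> unit_disk" for n z
    using that f\<phi>[of "s n" z] uh[OF that] s[of n] by (simp add: E_def composition_op_def)
  \<comment> \<open>The norm controls the value at the origin by definition, which fixes the constant of integration below.\<close>
  have at0: "deriv u (h 0) = \<mu> * u (h 0)"
  proof -
    have "(\<lambda>n. E n 0) \<longlonglongrightarrow> deriv u (h 0) - \<mu> * u (h 0)"
      unfolding Eeq[OF centre_in_ball[THEN iffD2, OF zero_less_one]] s_def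
      by (intro tendsto_intros difference_quotient_LIMSEQ[OF holu open\<Omega>]) (simp add: h\<Omega>)
    moreover have "(\<lambda>n. E n 0) \<longlonglongrightarrow> 0"
      by (rule Lim_null_comparison[OF _ Elim]) (simp add: norm_at_zero_le_dirichlet_norm)
    ultimately have "deriv u (h 0) - \<mu> * u (h 0) = 0"
      using LIMSEQ_unique by blast
    then show ?thesis by simp
  qed
  \<comment> \<open>The pointwise limit of the derivatives of the errors.\<close>
  define Q where "Q z = deriv h z * (deriv (deriv u) (h z) - \<mu> * deriv u (h z))" for z
  have dE: "deriv (E n) z = deriv h z * ((deriv u (h z + of_real (s n)) - deriv u (h z)) / of_real (s n) - \<mu> * deriv u (h z))"
    if z: "z \<in> unit_disk" for n z
  proof -
    have dh: "(h has_field_derivative deriv h z) (at z)"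
      using holh z by (simp add: holomorphic_derivI)
    have du: "(u has_field_derivative deriv u w) (at w)" if "w \<in> \<Omega>" for w
      using holu open\<Omega> that by (simp add: holomorphic_derivI)
    have "((\<lambda>z. (u (h z + of_real (s n)) - u (h z)) / of_real (s n) - \<mu> * u (h z)) has_field_derivative
       (deriv u (h z + of_real (s n)) * deriv h z - deriv u (h z) * deriv h z) / of_real (s n)
        - \<mu> * (deriv u (h z) * deriv h z)) (at z)"
      using s[of n] z
      by (intro DERIV_diff DERIV_cdivide DERIV_cmult DERIV_chain2[OF du dh] h\<Omega>
          DERIV_chain2[OF du DERIV_add[OF dh DERIV_const, simplified]] shift) auto
    then have "deriv (\<lambda>z. (u (h z + of_real (s n)) - u (h z)) / of_real (s n) - \<mu> * u (h z)) z =
       (deriv u (h z + of_real (s n)) * deriv h z - deriv u (h z) * deriv h z) / of_real (s n)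
        - \<mu> * (deriv u (h z) * deriv h z)"
      by (rule DERIV_imp_deriv)
    also have "deriv (\<lambda>z. (u (h z + of_real (s n)) - u (h z)) / of_real (s n) - \<mu> * u (h z)) z = deriv (E n) z"
      by (rule deriv_cong_on_disk[OF _ z]) (simp only: Eeq)
    finally show ?thesis by (simp add: field_simps)
  qed
  have dElim: "(\<lambda>n. deriv (E n) z) \<longlonglongrightarrow> Q z" if z: "z \<in> unit_disk" for z
    unfolding dE[OF z] Q_def s_def
    by (intro tendsto_intros difference_quotient_LIMSEQ[OF holu' open\<Omega>] h\<Omega> z)
  have holQ: "Q holomorphic_on unit_disk"
    unfolding Q_def
    by (intro holomorphic_intros holomorphic_deriv[OF holh]
        holomorphic_on_compose_gen[OF holh holomorphic_deriv[OF holu' open\<Omega>], unfolded o_def]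
        holomorphic_on_compose_gen[OF holh holu', unfolded o_def]) (auto simp: \<Omega>_def)
  have meas: "(\<lambda>z. ennreal ((cmod (deriv (E n) z))\<^sup>2) * indicator unit_disk z) \<in> borel_measurable lborel" 
    if "E n holomorphic_on unit_disk" for n
  proof -
    have "continuous_on unit_disk (\<lambda>z. (cmod (deriv (E n) z))\<^sup>2)"
      by (intro continuous_intros holomorphic_on_imp_continuous_on[OF holomorphic_deriv[OF that open_ball]])
    then have "(\<lambda>z. indicator unit_disk z *\<^sub>R (cmod (deriv (E n) z))\<^sup>2) \<in> borel_measurable borel"
      by (intro borel_measurable_continuous_on_indicator) auto
    then have "(\<lambda>z. ennreal (indicator unit_disk z *\<^sub>R (cmod (deriv (E n) z))\<^sup>2)) \<in> borel_measurable lborel"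
      by simp
    also have "(\<lambda>z. ennreal (indicator unit_disk z *\<^sub>R (cmod (deriv (E n) z))\<^sup>2))
       = (\<lambda>z. ennreal ((cmod (deriv (E n) z))\<^sup>2) * indicator unit_disk z)"
      by (auto simp: indicator_def)
    finally show ?thesis .
  qed
  have "\<And>n. E n holomorphic_on unit_disk"
  proof -
    fix n
    have "(\<lambda>z. (u (h z + of_real (s n)) - u (h z)) / of_real (s n) - \<mu> * u (h z)) holomorphic_on unit_disk"
      using s[of n] shift[of "s n"]
      by (intro holomorphic_intros holomorphic_on_compose_gen[OF holh holu, unfolded o_def]
          holomorphic_on_compose_gen[OF _ holu, unfolded o_def, of "\<lambda>z. h z + of_real (s n)"] holh)
         (auto simp: \<Omega>_def)
    then show "E n holomorphic_on unit_disk"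
      by (rule holomorphic_transform) (simp add: Eeq)
  qed
  note meas = meas[OF this]
  have "(\<integral>\<^sup>+z\<in>unit_disk. ennreal ((cmod (Q z))\<^sup>2) \<partial>lborel)
      = (\<integral>\<^sup>+z. liminf (\<lambda>n. ennreal ((cmod (deriv (E n) z))\<^sup>2) * indicator unit_disk z) \<partial>lborel)"
  proof (rule nn_integral_cong)
    fix z
    show "ennreal ((cmod (Q z))\<^sup>2) * indicator unit_disk z
        = liminf (\<lambda>n. ennreal ((cmod (deriv (E n) z))\<^sup>2) * indicator unit_disk z)"
    proof (cases "z \<in> unit_disk")
      case True
      have "(\<lambda>n. ennreal ((cmod (deriv (E n) z))\<^sup>2)) \<longlonglongrightarrow> ennreal ((cmod (Q z))\<^sup>2)"
        by (intro tendsto_ennrealI tendsto_intros dElim True)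
      then have "liminf (\<lambda>n. ennreal ((cmod (deriv (E n) z))\<^sup>2)) = ennreal ((cmod (Q z))\<^sup>2)"
        by (intro lim_imp_Liminf) auto
      then show ?thesis using True by simp
    next
      case False
      then show ?thesis by (simp add: Liminf_const)
    qed
  qed
  also have "\<dots> \<le> liminf (\<lambda>n. \<integral>\<^sup>+z\<in>unit_disk. ennreal ((cmod (deriv (E n) z))\<^sup>2) \<partial>lborel)"
    by (rule nn_integral_liminf) (rule meas)
  also have "\<dots> \<le> liminf (\<lambda>n. ennreal (pi * (dirichlet_norm (E n))\<^sup>2))"
    by (rule Liminf_mono) (rule eventually_mono[OF ED dirichlet_integral_le_dirichlet_norm])
  also have "\<dots> = 0"
  proof -
    have "(\<lambda>n. ennreal (pi * (dirichlet_norm (E n))\<^sup>2)) \<longlonglongrightarrow> ennreal (pi * 0\<^sup>2)"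
      by (intro tendsto_ennrealI tendsto_intros Elim)
    then show ?thesis by (intro lim_imp_Liminf) auto
  qed
  finally have "(\<integral>\<^sup>+z\<in>unit_disk. ennreal ((cmod (Q z))\<^sup>2) \<partial>lborel) = 0" by simp
  then have "(cmod (Q z))\<^sup>2 = 0" if "z \<in> unit_disk" for z
    by (rule continuous_null_integral_imp_zero[OF open_ball _ _ _ that, rotated 2])
       (auto intro!: continuous_intros holomorphic_on_imp_continuous_on holQ)
  then have Q0: "Q z = 0" if "z \<in> unit_disk" for z
    using that by simp
  have ode2: "deriv (deriv u) w - \<mu> * deriv u w = 0" if "w \<in> \<Omega>" for w
  proof -
    from that obtain z where z: "z \<in> unit_disk" "w = h z" unfolding \<Omega>_def by blast
    then show ?thesis using Q0[of z] dF[of z] by (auto simp: Q_def)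
  qed
  have du: "(u has_field_derivative deriv u w) (at w)" if "w \<in> \<Omega>" for w
    using holu open\<Omega> that by (simp add: holomorphic_derivI)
  have ddu: "(deriv u has_field_derivative deriv (deriv u) w) (at w)" if "w \<in> \<Omega>" for w
    using holu' open\<Omega> that by (simp add: holomorphic_derivI)
  have "((\<lambda>w. deriv u w - \<mu> * u w) has_field_derivative 0) (at w)" if "w \<in> \<Omega>" for w
    using DERIV_diff[OF ddu[OF that] DERIV_cmult[OF du[OF that], of \<mu>]] ode2[OF that] by simp
  then obtain c1 where c1: "\<And>w. w \<in> \<Omega> \<Longrightarrow> deriv u w - \<mu> * u w = c1"
    using DERIV_zero_connected_constant[OF conn\<Omega> open\<Omega>, of "{}" "\<lambda>w. deriv u w - \<mu> * u w"] 
      holomorphic_on_imp_continuous_on[of "\<lambda>w. deriv u w - \<mu> * u w" \<Omega>] holu holu'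
    by (force intro!: holomorphic_intros)
  have "c1 = 0"
    using c1[OF h\<Omega>[of 0]] at0 by simp
  then have ode1: "deriv u w = \<mu> * u w" if "w \<in> \<Omega>" for w
    using c1[OF that] by simp
  have "((\<lambda>w. u w * exp (- (\<mu> * w))) has_field_derivative 0) (at w)" if "w \<in> \<Omega>" for w
    by (rule derivative_eq_intros du[OF that] refl)+ (simp add: ode1[OF that] algebra_simps)
  then obtain c where c: "\<And>w. w \<in> \<Omega> \<Longrightarrow> u w * exp (- (\<mu> * w)) = c"
    using DERIV_zero_connected_constant[OF conn\<Omega> open\<Omega>, of "{}" "\<lambda>w. u w * exp (- (\<mu> * w))"] 
      holomorphic_on_imp_continuous_on[of "\<lambda>w. u w * exp (- (\<mu> * w))" \<Omega>] holu
    by (force intro!: holomorphic_intros)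
  show ?thesis
  proof (intro exI ballI)
    fix z assume z: "z \<in> unit_disk"
    have "f z * exp (- (\<mu> * h z)) = c" using c[OF h\<Omega>[OF z]] uh[OF z] by simp
    then show "f z = c * exp (\<mu> * h z)"
      by (metis exp_minus_inverse mult.assoc mult.commute mult.right_neutral)
  qed
qed

text \<open>
  On the disk, \<open>exp (\<mu> h) \<circ> \<phi> t = exp (\<mu> t) exp (\<mu> h)\<close>, so the difference quotients of this function
  are scalar multiples of it, and membership in the space is all that an eigenvector requires.
\<close>

lemma dirichlet_point_spectrum_iff_exp:
  assumes sg: "holomorphic_semigroup \<phi>" and koenigs: "koenigs_function \<phi> h"
  shows "\<mu> \<in> dirichlet_point_spectrum \<phi> \<longleftrightarrow> (\<lambda>z. exp (\<mu> * h z)) \<in> dirichlet_space"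
proof
  assume "\<mu> \<in> dirichlet_point_spectrum \<phi>"
  then obtain f z0 where z0: "z0 \<in> unit_disk" "f z0 \<noteq> 0" and gen: "dirichlet_generator \<phi> f (\<lambda>z. \<mu> * f z)"
    by (auto simp: dirichlet_point_spectrum_def)
  obtain c where c: "\<And>z. z \<in> unit_disk \<Longrightarrow> f z = c * exp (\<mu> * h z)"
    using generator_eigenfunction[OF sg koenigs gen] by blast
  have "c \<noteq> 0" using c[OF z0(1)] z0(2) by auto
  have "(\<lambda>z. inverse c * f z) \<in> dirichlet_space"
    using gen by (intro dirichlet_space_cmult) (simp add: dirichlet_generator_def)
  also have "?this \<longleftrightarrow> (\<lambda>z. exp (\<mu> * h z)) \<in> dirichlet_space"
    using \<open>c \<noteq> 0\<close> by (intro dirichlet_space_cong) (simp only: c, simp)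
  finally show "(\<lambda>z. exp (\<mu> * h z)) \<in> dirichlet_space" .
next
  define f where "f = (\<lambda>z. exp (\<mu> * h z))"
  assume "(\<lambda>z. exp (\<mu> * h z)) \<in> dirichlet_space"
  then have fD: "f \<in> dirichlet_space" by (simp add: f_def)
  define q where "q t = (exp (\<mu> * of_real t) - 1) / of_real t" for t :: real
  have quot: "(composition_op \<phi> t f z - f z) / of_real t = q t * f z"
    if "t > 0" "z \<in> unit_disk" for t z
  proof -
    have "h (\<phi> t z) = h z + of_real t"
      using koenigs that unfolding koenigs_function_def by (meson less_imp_le)
    then show ?thesis
      by (simp add: composition_op_def f_def q_def distrib_left exp_add algebra_simps diff_divide_distrib)
  qed
  have pos: "\<forall>\<^sub>F t :: real in at_right 0. t > 0"
    by (simp add: eventually_at_right_less)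
  have qlim: "(q \<longlongrightarrow> \<mu>) (at_right 0)"
  proof -
    have "((\<lambda>x. exp (\<mu> * x)) has_field_derivative \<mu>) (at 0)"
      by (auto intro!: derivative_eq_intros)
    then have "((\<lambda>k. (exp (\<mu> * k) - 1) / k) \<longlongrightarrow> \<mu>) (at 0)"
      by (simp add: DERIV_def)
    moreover have "filterlim complex_of_real (at 0) (at_right 0)"
      unfolding filterlim_at using pos
      by (auto intro!: tendsto_eq_intros elim: eventually_mono)
    ultimately show ?thesis
      unfolding q_def[abs_def] by (rule filterlim_compose)
  qed
  have "dirichlet_tendsto (\<lambda>t z. (composition_op \<phi> t f z - f z) / of_real t) (\<lambda>z. \<mu> * f z) (at_right 0)"
    unfolding dirichlet_tendsto_def
  proof (intro conjI)
    show "(\<lambda>z. \<mu> * f z) \<in> dirichlet_space" by (rule dirichlet_space_cmult[OF fD])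
    show "\<forall>\<^sub>F t in at_right 0. (\<lambda>z. (composition_op \<phi> t f z - f z) / of_real t) \<in> dirichlet_space"
      using pos
    proof eventually_elim
      case (elim t)
      have "(\<lambda>z. (composition_op \<phi> t f z - f z) / of_real t) \<in> dirichlet_space \<longleftrightarrow>
          (\<lambda>z. q t * f z) \<in> dirichlet_space"
        by (rule dirichlet_space_cong) (rule quot[OF elim])
      then show ?case using dirichlet_space_cmult[OF fD] by blast
    qed
    have norm: "\<forall>\<^sub>F t in at_right 0. dirichlet_norm (\<lambda>z. (composition_op \<phi> t f z - f z) / of_real t - \<mu> * f z)
        = cmod (q t - \<mu>) * dirichlet_norm f"
      using pos
    proof eventually_elim
      case (elim t)
      have "dirichlet_norm (\<lambda>z. (composition_op \<phi> t f z - f z) / of_real t - \<mu> * f z)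
          = dirichlet_norm (\<lambda>z. (q t - \<mu>) * f z)"
        by (rule dirichlet_norm_cong) (simp only: quot[OF elim] left_diff_distrib)
      then show ?case by (simp only: dirichlet_norm_cmult[OF dirichlet_spaceD(1)[OF fD]])
    qed
    have "((\<lambda>t. cmod (q t - \<mu>) * dirichlet_norm f) \<longlongrightarrow> cmod (\<mu> - \<mu>) * dirichlet_norm f) (at_right 0)"
      by (intro tendsto_intros qlim)
    then show "((\<lambda>t. dirichlet_norm (\<lambda>z. (composition_op \<phi> t f z - f z) / of_real t - \<mu> * f z)) \<longlongrightarrow> 0) (at_right 0)"
      using tendsto_cong[OF norm] by simp
  qed
  then have "dirichlet_generator \<phi> f (\<lambda>z. \<mu> * f z)"
    using fD by (simp add: dirichlet_generator_def)
  moreover have "\<exists>z\<in>unit_disk. f z \<noteq> 0"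
    by (intro bexI[of _ 0]) (auto simp: f_def)
  ultimately show "\<mu> \<in> dirichlet_point_spectrum \<phi>"
    by (auto simp: dirichlet_point_spectrum_def)
qed

lemma exp_koenigs_in_dirichlet_space_iff:
  assumes holh: "h holomorphic_on unit_disk" and injh: "inj_on h unit_disk"
  shows "(\<lambda>z. exp (\<mu> * h z)) \<in> dirichlet_space \<longleftrightarrow>
    \<mu> = 0 \<or> set_integrable lborel (h ` unit_disk) (\<lambda>w. exp (2 * Re (\<mu> * w)))"
proof -
  have hol: "(\<lambda>z. exp (\<mu> * h z)) holomorphic_on unit_disk"
    by (intro holomorphic_intros holh)
  have der: "(cmod (deriv (\<lambda>z. exp (\<mu> * h z)) z))\<^sup>2 = (cmod \<mu>)\<^sup>2 * ((cmod (deriv h z))\<^sup>2 * exp (2 * Re (\<mu> * h z)))"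
    if "z \<in> unit_disk" for z
  proof -
    have "(h has_field_derivative deriv h z) (at z)"
      using holomorphic_derivI[OF holh open_ball that] .
    then have "((\<lambda>z. exp (\<mu> * h z)) has_field_derivative exp (\<mu> * h z) * (\<mu> * deriv h z)) (at z)"
      by (auto intro!: derivative_eq_intros)
    then have "deriv (\<lambda>z. exp (\<mu> * h z)) z = exp (\<mu> * h z) * (\<mu> * deriv h z)"
      by (rule DERIV_imp_deriv)
    then show ?thesis
      by (simp only: norm_mult power_mult_distrib norm_exp_eq_Re exp_double mult_ac)
  qed
  have "(\<lambda>z. exp (\<mu> * h z)) \<in> dirichlet_space \<longleftrightarrow>
      set_integrable lborel unit_disk (\<lambda>z. (cmod (deriv (\<lambda>z. exp (\<mu> * h z)) z))\<^sup>2)"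
    using hol by (simp add: dirichlet_space_def)
  also have "\<dots> \<longleftrightarrow> set_integrable lborel unit_disk
      (\<lambda>z. (cmod \<mu>)\<^sup>2 * ((cmod (deriv h z))\<^sup>2 * exp (2 * Re (\<mu> * h z))))"
    using der by (intro set_integrable_cong refl) metis
  also have "\<dots> \<longleftrightarrow> \<mu> = 0 \<or> set_integrable lborel unit_disk (\<lambda>z. (cmod (deriv h z))\<^sup>2 * exp (2 * Re (\<mu> * h z)))"
    by (cases "\<mu> = 0") (simp add: set_integrable_def, simp only: set_integrable_mult_right_iff zero_eq_power2 norm_eq_zero simp_thms)
  also have "set_integrable lborel unit_disk (\<lambda>z. (cmod (deriv h z))\<^sup>2 * exp (2 * Re (\<mu> * h z))) \<longleftrightarrow>
      set_integrable lborel (h ` unit_disk) (\<lambda>w. exp (2 * Re (\<mu> * w)))"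
    by (rule set_integrable_conformal_change_of_variables[OF open_ball holh injh])
       (intro continuous_intros)
  finally show ?thesis .
qed

section \<open>Reduction to weighted areas\<close>

text \<open>
  In a horizontal strip the factor \<open>exp (- 2 Im \<mu> Im w)\<close> is bounded above and below by positive
  constants, so the integrand is comparable to a function of \<open>Re w\<close>.
\<close>

lemma strip_exp_integrable_iff:
  assumes \<Omega>: "open \<Omega>" and strip: "\<And>w. w \<in> \<Omega> \<Longrightarrow> \<bar>Im w\<bar> \<le> Y"
  shows "set_integrable lborel \<Omega> (\<lambda>w. exp (2 * Re (\<mu> * w))) \<longleftrightarrow>
    (\<integral>\<^sup>+x. ennreal (exp (2 * Re \<mu> * x)) * slice_length \<Omega> x \<partial>lborel) < \<infinity>"
proof -
  define K where "K = exp (2 * (\<bar>Im \<mu>\<bar> * Y))"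
  have meas: "set_borel_measurable lborel \<Omega> f" if "continuous_on UNIV f" for f :: "complex \<Rightarrow> real"
  proof -
    have "(\<lambda>w. indicator \<Omega> w *\<^sub>R f w) \<in> borel_measurable borel"
      using \<Omega> continuous_on_subset[OF that] by (intro borel_measurable_continuous_on_indicator) auto
    then show ?thesis by (simp add: set_borel_measurable_def)
  qed
  have mu: "set_borel_measurable lborel \<Omega> (\<lambda>w. exp (2 * Re (\<mu> * w)))"
    by (intro meas continuous_intros)
  have mr: "set_borel_measurable lborel \<Omega> (\<lambda>w. exp (2 * Re \<mu> * Re w))"
    by (intro meas continuous_intros)
  have osc: "\<bar>Im \<mu> * Im w\<bar> \<le> \<bar>Im \<mu>\<bar> * Y" if "w \<in> \<Omega>" for w
    using strip[OF that] by (simp add: abs_mult mult_left_mono)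
  have up: "exp (2 * Re (\<mu> * w)) \<le> K * exp (2 * Re \<mu> * Re w)"
    and low: "exp (2 * Re \<mu> * Re w) \<le> K * exp (2 * Re (\<mu> * w))" if "w \<in> \<Omega>" for w
    using osc[OF that] unfolding K_def exp_add[symmetric] exp_le_cancel_iff
    by (simp_all add: algebra_simps abs_le_iff)
  have "set_integrable lborel \<Omega> (\<lambda>w. exp (2 * Re (\<mu> * w))) \<longleftrightarrow>
      set_integrable lborel \<Omega> (\<lambda>w. exp (2 * Re \<mu> * Re w))"
  proof
    assume "set_integrable lborel \<Omega> (\<lambda>w. exp (2 * Re (\<mu> * w)))"
    then have "set_integrable lborel \<Omega> (\<lambda>w. K * exp (2 * Re (\<mu> * w)))"
      by (rule set_integrable_mult_right)
    then show "set_integrable lborel \<Omega> (\<lambda>w. exp (2 * Re \<mu> * Re w))"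
      by (rule set_integrable_bound[OF _ mr]) (use low in \<open>auto intro!: AE_I2 order_trans[OF _ abs_ge_self]\<close>)
  next
    assume "set_integrable lborel \<Omega> (\<lambda>w. exp (2 * Re \<mu> * Re w))"
    then have "set_integrable lborel \<Omega> (\<lambda>w. K * exp (2 * Re \<mu> * Re w))"
      by (rule set_integrable_mult_right)
    then show "set_integrable lborel \<Omega> (\<lambda>w. exp (2 * Re (\<mu> * w)))"
      by (rule set_integrable_bound[OF _ mu]) (use up in \<open>auto intro!: AE_I2 order_trans[OF _ abs_ge_self]\<close>)
  qed
  also have "\<dots> \<longleftrightarrow> (\<integral>\<^sup>+w\<in>\<Omega>. ennreal (exp (2 * Re \<mu> * Re w)) \<partial>lborel) < \<infinity>"
    by (rule set_nn_integral_finite_iff_set_integrable[OF mr]) simp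
  also have "(\<integral>\<^sup>+w\<in>\<Omega>. ennreal (exp (2 * Re \<mu> * Re w)) \<partial>lborel)
      = (\<integral>\<^sup>+x. ennreal (exp (2 * Re \<mu> * x)) * slice_length \<Omega> x \<partial>lborel)"
    by (rule nn_integral_over_slices[OF \<Omega>]) (intro measurable_compose[OF _ measurable_ennreal] borel_measurable_continuous_onI continuous_intros)
  finally show ?thesis .
qed

lemma emeasure_lborel_half_line:
  fixes X :: real
  shows "emeasure lborel {X<..} = \<infinity>" "emeasure lborel {..X} = \<infinity>"
proof -
  have unbounded: "e = \<infinity>" if "\<And>n. of_nat n \<le> e" for e :: ennreal
    using that ennreal_Ex_less_of_nat[of e] by (metis infinity_ennreal_def less_top linorder_not_le)
  show "emeasure lborel {X<..} = \<infinity>"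
  proof (rule unbounded)
    fix n :: nat
    have "emeasure lborel {X<..X + real n} \<le> emeasure lborel {X<..}"
      by (intro emeasure_mono) auto
    then show "of_nat n \<le> emeasure lborel {X<..}" by (simp add: ennreal_of_nat_eq_real_of_nat)
  qed
  show "emeasure lborel {..X} = \<infinity>"
  proof (rule unbounded)
    fix n :: nat
    have "emeasure lborel {X - real n..X} \<le> emeasure lborel {..X}"
      by (intro emeasure_mono) auto
    then show "of_nat n \<le> emeasure lborel {..X}" by (simp add: ennreal_of_nat_eq_real_of_nat)
  qed
qed

lemma nn_integral_exp_right:
  fixes a X :: real
  assumes "a < 0"
  shows "(\<integral>\<^sup>+x\<in>{X..}. ennreal (exp (a * x)) \<partial>lborel) < \<infinity>"
proof -
  have "(\<integral>\<^sup>+x\<in>{X..}. ennreal (exp (a * x)) \<partial>lborel) = ennreal (0 - exp (a * X) / a)"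
  proof (rule nn_integral_FTC_atLeast)
    show "(\<lambda>x. exp (a * x)) \<in> borel_measurable borel"
      by (intro borel_measurable_continuous_onI continuous_intros)
    show "((\<lambda>x. exp (a * x) / a) has_real_derivative exp (a * x)) (at x)" for x
      using assms by (auto intro!: derivative_eq_intros)
    have "filterlim (\<lambda>x. a * x) at_bot at_top"
      using assms by (intro filterlim_tendsto_neg_mult_at_bot[OF tendsto_const] filterlim_ident)
    then have "((\<lambda>x. exp (a * x)) \<longlongrightarrow> 0) at_top"
      by (rule filterlim_compose[OF exp_at_bot])
    then show "((\<lambda>x. exp (a * x) / a) \<longlongrightarrow> 0) at_top"
      using tendsto_divide[OF _ tendsto_const[of a]] assms by fastforce
  qed auto
  then show ?thesis by simp
qed

lemma nn_integral_exp_left: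
  fixes a X :: real
  assumes "0 < a"
  shows "(\<integral>\<^sup>+x\<in>{..X}. ennreal (exp (a * x)) \<partial>lborel) < \<infinity>"
proof -
  have "(\<integral>\<^sup>+x\<in>{..X}. ennreal (exp (a * x)) \<partial>lborel)
      = (\<integral>\<^sup>+x. ennreal (exp (a * x)) * indicator {..X} x \<partial>distr lborel borel uminus)"
    using lborel_distr_uminus by simp
  also have "\<dots> = (\<integral>\<^sup>+x. ennreal (exp (a * (- x))) * indicator {..X} (- x) \<partial>lborel)"
    by (rule nn_integral_distr) (auto intro!: borel_measurable_times_ennreal measurable_compose[OF _ measurable_ennreal] borel_measurable_continuous_onI continuous_intros)
  also have "\<dots> = (\<integral>\<^sup>+x\<in>{- X..}. ennreal (exp ((- a) * x)) \<partial>lborel)"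
    by (intro nn_integral_cong) (auto simp: indicator_def)
  also have "\<dots> < \<infinity>"
    using assms by (intro nn_integral_exp_right) simp
  finally show ?thesis .
qed

text \<open>
  To the right of the imaginary axis the slice lengths are bounded by the width of the strip and, because
  the domain is invariant under translation to the right, eventually bounded away from zero. The right
  half of the integral therefore converges exactly when \<open>a < 0\<close>.
\<close>

lemma slice_integral_finite_iff:
  assumes \<Omega>: "open \<Omega>" "\<Omega> \<noteq> {}" and strip: "\<And>w. w \<in> \<Omega> \<Longrightarrow> \<bar>Im w\<bar> \<le> Y"
    and shift: "\<And>w t. w \<in> \<Omega> \<Longrightarrow> 0 \<le> t \<Longrightarrow> w + of_real t \<in> \<Omega>"
  shows "(\<integral>\<^sup>+x. ennreal (exp (2 * a * x)) * slice_length \<Omega> x \<partial>lborel) < \<infinity> \<longleftrightarrow>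
    a < 0 \<and> weighted_left_area \<Omega> (- a) < \<infinity>"
proof -
  note [measurable] = measurable_slice_length[OF \<Omega>(1)]
  have [measurable]: "(\<lambda>x::real. ennreal (exp (2 * a * x))) \<in> borel_measurable lborel"
    by simp
  define k where "k x = ennreal (exp (2 * a * x)) * slice_length \<Omega> x" for x
  have mk [measurable]: "k \<in> borel_measurable lborel"
    unfolding k_def[abs_def] by measurable
  have left: "(\<integral>\<^sup>+x\<in>{..0}. k x \<partial>lborel) = weighted_left_area \<Omega> (- a)"
    by (simp add: k_def weighted_left_area_def)
  have split: "(\<integral>\<^sup>+x. k x \<partial>lborel) = (\<integral>\<^sup>+x\<in>{..0}. k x \<partial>lborel) + (\<integral>\<^sup>+x\<in>{0<..}. k x \<partial>lborel)"
    by (subst nn_integral_add[symmetric]) (auto intro!: nn_integral_cong simp: indicator_def)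
  have right: "(\<integral>\<^sup>+x\<in>{0<..}. k x \<partial>lborel) < \<infinity> \<longleftrightarrow> a < 0"
  proof
    assume "a < 0"
    have len: "slice_length \<Omega> x \<le> ennreal (2 * \<bar>Y\<bar>)" for x
    proof -
      have "slice_length \<Omega> x \<le> emeasure lborel {- \<bar>Y\<bar>..\<bar>Y\<bar>}"
        unfolding slice_length_def
        by (rule emeasure_mono) (use strip[of "Complex x _"] in \<open>fastforce\<close>)+
      then show ?thesis by simp
    qed
    have "(\<integral>\<^sup>+x\<in>{0<..}. k x \<partial>lborel) \<le> (\<integral>\<^sup>+x. ennreal (2 * \<bar>Y\<bar>) * (ennreal (exp ((2 * a) * x)) * indicator {0..} x) \<partial>lborel)"
    proof (rule nn_integral_mono)
      fix x :: real
      have "k x \<le> ennreal (2 * \<bar>Y\<bar>) * ennreal (exp ((2 * a) * x))"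
        unfolding k_def by (subst mult.commute) (rule mult_right_mono[OF len], simp)
      then show "k x * indicator {0<..} x \<le> ennreal (2 * \<bar>Y\<bar>) * (ennreal (exp ((2 * a) * x)) * indicator {0..} x)"
        by (auto simp: indicator_def)
    qed
    also have "\<dots> = ennreal (2 * \<bar>Y\<bar>) * (\<integral>\<^sup>+x\<in>{0..}. ennreal (exp ((2 * a) * x)) \<partial>lborel)"
      by (rule nn_integral_cmult) simp
    also have "\<dots> < \<infinity>"
      using nn_integral_exp_right[of "2 * a" 0] \<open>a < 0\<close> by (simp add: ennreal_mult_less_top)
    finally show "(\<integral>\<^sup>+x\<in>{0<..}. k x \<partial>lborel) < \<infinity>" .
  next
    assume fin: "(\<integral>\<^sup>+x\<in>{0<..}. k x \<partial>lborel) < \<infinity>"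
    show "a < 0"
    proof (rule ccontr)
      assume "\<not> a < 0"
      obtain w e where w: "w \<in> \<Omega>" "e > 0" "ball w e \<subseteq> \<Omega>"
        using \<Omega> by (meson ex_in_conv open_contains_ball)
      \<comment> \<open>Every slice to the right of \<open>w\<close> contains a translate of the vertical diameter of the ball.\<close>
      define X where "X = max 0 (Re w)"
      have len: "ennreal (2 * e) \<le> slice_length \<Omega> x" if "x \<ge> X" for x
      proof -
        have "{Im w - e<..<Im w + e} \<subseteq> {y. Complex x y \<in> \<Omega>}"
        proof
          fix y assume y: "y \<in> {Im w - e<..<Im w + e}"
          have "Complex (Re w) y \<in> ball w e"
            using y by (auto simp: dist_norm cmod_def)
          then have "Complex (Re w) y + of_real (x - Re w) \<in> \<Omega>"
            using w(3) that by (intro shift) (auto simp: X_def)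
          also have "Complex (Re w) y + of_real (x - Re w) = Complex x y"
            by (simp add: complex_eq_iff)
          finally show "y \<in> {y. Complex x y \<in> \<Omega>}" by simp
        qed
        then have "emeasure lborel {Im w - e<..<Im w + e} \<le> slice_length \<Omega> x"
          unfolding slice_length_def using slice_measurable[OF \<Omega>(1)] by (rule emeasure_mono)
        then show ?thesis using w(2) by simp
      qed
      have "\<infinity> = ennreal (2 * e) * emeasure lborel {X<..}"
        using w(2) by (simp add: ennreal_mult_top emeasure_lborel_half_line)
      also have "\<dots> = (\<integral>\<^sup>+x. ennreal (2 * e) * indicator {X<..} x \<partial>lborel)"
        by (simp add: nn_integral_cmult_indicator)
      also have "\<dots> \<le> (\<integral>\<^sup>+x\<in>{0<..}. k x \<partial>lborel)"
      proof (rule nn_integral_mono)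
        fix x
        show "ennreal (2 * e) * indicator {X<..} x \<le> k x * indicator {0<..} x"
        proof (cases "x > X")
          case True
          then have "x > 0" by (simp add: X_def)
          then have "1 \<le> ennreal (exp (2 * a * x))"
            using \<open>\<not> a < 0\<close> by (simp add: ennreal_1[symmetric] del: ennreal_1)
          then have "1 * ennreal (2 * e) \<le> k x"
            unfolding k_def using True by (intro mult_mono len) auto
          then show ?thesis using True \<open>x > 0\<close> by simp
        qed simp
      qed
      finally show False using fin by simp
    qed
  qed
  show ?thesis
    using split left right by (auto simp: k_def[symmetric])
qed

lemma dirichlet_point_spectrum_iff:
  assumes hyp: "hyperbolic_semigroup \<phi>" and koenigs: "koenigs_function \<phi> h"
  shows "\<mu> \<in> dirichlet_point_spectrum \<phi> \<longleftrightarrow>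
    \<mu> = 0 \<or> Re \<mu> < 0 \<and> weighted_left_area (h ` unit_disk) (- Re \<mu>) < \<infinity>"
proof -
  have sg: "holomorphic_semigroup \<phi>"
    using hyp by (simp add: hyperbolic_semigroup_def non_elliptic_semigroup_def)
  obtain Y where Y: "\<And>w. w \<in> h ` unit_disk \<Longrightarrow> \<bar>Im w\<bar> \<le> Y"
    using hyperbolic_koenigs_domain_in_strip[OF hyp koenigs] by blast
  have op: "open (h ` unit_disk)"
    by (rule koenigs_domain_open_connected[OF koenigs])
  have hol: "h holomorphic_on unit_disk" "inj_on h unit_disk"
    using koenigs by (auto simp: koenigs_function_def)
  have ne: "h ` unit_disk \<noteq> {}" by auto
  note dirichlet_point_spectrum_iff_exp[OF sg koenigs]
  also note exp_koenigs_in_dirichlet_space_iff[OF hol]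
  also note strip_exp_integrable_iff[OF op Y]
  also note slice_integral_finite_iff[OF op ne Y koenigs_domain_shift[OF sg koenigs]]
  finally show ?thesis .
qed

section \<open>Decay rates and the five cases\<close>

text \<open>
  Dividing by \<open>2 x < 0\<close> reverses the inequality. For \<open>u = \<infinity>\<close> the quotient is \<open>- \<infinity>\<close>, which
  contradicts the hypothesis; for \<open>u = 0\<close> it is \<open>\<infinity>\<close>, and the conclusion is trivial.
\<close>

lemma ext_log_quotient_le:
  assumes "x < 0" "ereal b < ext_log u / ereal (2 * x)"
  shows "u \<le> ennreal (exp (2 * b * x))"
proof (cases "u = 0 \<or> u = \<infinity>")
  case True
  then show ?thesis using assms by (auto simp: ext_log_def divide_ereal_def)
next
  case False
  then obtain r where r: "u = ennreal r" "r > 0"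
    by (cases u) (auto simp: less_le)
  then have "b < ln r / (2 * x)"
    using assms by (simp add: ext_log_def)
  then have "ln r < 2 * b * x"
    using assms(1) by (simp add: field_simps)
  then have "r \<le> exp (2 * b * x)"
    using r(2) by (metis exp_le_cancel_iff exp_ln less_imp_le)
  then show ?thesis using r by (simp add: ennreal_leI)
qed

lemma ext_log_quotient_ge:
  assumes "x < 0" "ext_log u / ereal (2 * x) < ereal b"
  shows "ennreal (exp (2 * b * x)) \<le> u"
proof (cases "u = 0 \<or> u = \<infinity>")
  case True
  then show ?thesis using assms by (auto simp: ext_log_def divide_ereal_def)
next
  case False
  then obtain r where r: "u = ennreal r" "r > 0"
    by (cases u) (auto simp: less_le)
  then have "ln r / (2 * x) < b"
    using assms by (simp add: ext_log_def)
  then have "2 * b * x < ln r"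
    using assms(1) by (simp add: field_simps)
  then have "exp (2 * b * x) \<le> r"
    using r(2) by (metis exp_le_cancel_iff exp_ln less_imp_le)
  then show ?thesis using r by (simp add: ennreal_leI)
qed

text \<open>
  Choose \<open>b\<close> strictly between \<open>s\<close> and the decay rate. Far to the left the integrand is dominated by
  \<open>exp (2 (b - s) x)\<close>; on the remaining bounded interval the weight is bounded and the area is finite.
\<close>

lemma weighted_left_area_finite_below_decay_rate:
  assumes \<Omega>: "open \<Omega>" and area: "left_area \<Omega> < \<infinity>" and rate: "has_decay_rate \<Omega> \<delta>"
    and s: "0 \<le> s" "ereal s < \<delta>"
  shows "weighted_left_area \<Omega> s < \<infinity>"
proof -
  note [measurable] = measurable_slice_length[OF \<Omega>]
  obtain b where b: "s < b" "ereal b < \<delta>"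
    using ereal_dense2[OF s(2)] by auto
  have "\<forall>\<^sub>F x in at_bot. ereal b < ext_log (slice_length \<Omega> x) / ereal (2 * x)"
    using rate b(2) by (auto simp: has_decay_rate_def intro: order_tendstoD)
  then have "\<forall>\<^sub>F x in at_bot. x < 0 \<and> slice_length \<Omega> x \<le> ennreal (exp (2 * b * x))"
    using eventually_gt_at_bot[of "0::real"] by eventually_elim (use ext_log_quotient_le in blast)
  then obtain X where X: "\<And>x. x \<le> X \<Longrightarrow> x < 0 \<and> slice_length \<Omega> x \<le> ennreal (exp (2 * b * x))"
    by (auto simp: eventually_at_bot_linorder)
  have "weighted_left_area \<Omega> s \<le> (\<integral>\<^sup>+x. ennreal (exp (2 * (b - s) * x)) * indicator {..X} x
      + ennreal (exp (- 2 * s * X)) * (slice_length \<Omega> x * indicator {..0} x) \<partial>lborel)"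
    unfolding weighted_left_area_def
  proof (rule nn_integral_mono)
    fix x :: real
    show "ennreal (exp (- 2 * s * x)) * slice_length \<Omega> x * indicator {..0} x
      \<le> ennreal (exp (2 * (b - s) * x)) * indicator {..X} x
      + ennreal (exp (- 2 * s * X)) * (slice_length \<Omega> x * indicator {..0} x)"
    proof (cases "x \<le> X")
      case True
      have "ennreal (exp (- 2 * s * x)) * slice_length \<Omega> x \<le> ennreal (exp (- 2 * s * x)) * ennreal (exp (2 * b * x))"
        using X[OF True] by (intro mult_left_mono) auto
      also have "\<dots> = ennreal (exp (2 * (b - s) * x))"
        by (simp add: ennreal_mult[symmetric] exp_add[symmetric] algebra_simps)
      finally show ?thesis
        using True X[OF True] by (simp add: add_increasing2)
    next
      case False
      then have "exp (- 2 * s * x) \<le> exp (- 2 * s * X)"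
        using s by (simp add: mult_left_mono)
      then show ?thesis
        using False by (auto simp: mult.assoc intro!: mult_right_mono ennreal_leI)
    qed
  qed
  also have "\<dots> = (\<integral>\<^sup>+x\<in>{..X}. ennreal (exp (2 * (b - s) * x)) \<partial>lborel) + ennreal (exp (- 2 * s * X)) * left_area \<Omega>"
    unfolding left_area_def by (subst nn_integral_add) (simp_all add: nn_integral_cmult)
  also have "\<dots> < \<infinity>"
    using nn_integral_exp_left[of "2 * (b - s)" X] b(1) area by (simp add: ennreal_mult_less_top)
  finally show ?thesis .
qed

text \<open>
  Far to the left the slice length exceeds \<open>exp (2 s x)\<close>, so the integrand is at least \<open>1\<close> on a half-line.
\<close>

lemma weighted_left_area_infinite_above_decay_rate:
  assumes rate: "has_decay_rate \<Omega> \<delta>" and s: "\<delta> < ereal s"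
  shows "weighted_left_area \<Omega> s = \<infinity>"
proof -
  have "\<forall>\<^sub>F x in at_bot. ext_log (slice_length \<Omega> x) / ereal (2 * x) < ereal s"
    using rate s by (auto simp: has_decay_rate_def intro: order_tendstoD)
  then have "\<forall>\<^sub>F x in at_bot. x < 0 \<and> ennreal (exp (2 * s * x)) \<le> slice_length \<Omega> x"
    using eventually_gt_at_bot[of "0::real"] by eventually_elim (use ext_log_quotient_ge in blast)
  then obtain X where X: "\<And>x. x \<le> X \<Longrightarrow> x < 0 \<and> ennreal (exp (2 * s * x)) \<le> slice_length \<Omega> x"
    by (auto simp: eventually_at_bot_linorder)
  have "\<infinity> = emeasure lborel {..X}" by (simp add: emeasure_lborel_half_line)
  also have "\<dots> = (\<integral>\<^sup>+x. indicator {..X} x \<partial>lborel)" by simp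
  also have "\<dots> \<le> weighted_left_area \<Omega> s"
    unfolding weighted_left_area_def
  proof (rule nn_integral_mono)
    fix x :: real
    show "indicator {..X} x \<le> ennreal (exp (- 2 * s * x)) * slice_length \<Omega> x * indicator {..0} x"
    proof (cases "x \<le> X")
      case True
      have "1 = ennreal (exp (- 2 * s * x)) * ennreal (exp (2 * s * x))"
        by (simp add: ennreal_mult[symmetric] exp_add[symmetric])
      also have "\<dots> \<le> ennreal (exp (- 2 * s * x)) * slice_length \<Omega> x"
        using X[OF True] by (intro mult_left_mono) auto
      finally show ?thesis using True X[OF True] by simp
    qed simp
  qed
  finally show ?thesis by (simp add: top.extremum_unique)
qed

lemma left_area_le_weighted_left_area:
  assumes "0 \<le> s"
  shows "left_area \<Omega> \<le> weighted_left_area \<Omega> s"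
  unfolding left_area_def weighted_left_area_def
proof (rule nn_integral_mono)
  fix x :: real
  show "slice_length \<Omega> x * indicator {..0} x \<le> ennreal (exp (- 2 * s * x)) * slice_length \<Omega> x * indicator {..0} x"
  proof (cases "x \<le> 0")
    case True
    then have "1 \<le> ennreal (exp (- 2 * s * x))"
      using assms by (simp add: ennreal_1[symmetric] mult_nonneg_nonpos del: ennreal_1)
    then have "1 * slice_length \<Omega> x \<le> ennreal (exp (- 2 * s * x)) * slice_length \<Omega> x"
      by (rule mult_right_mono) simp
    then show ?thesis using True by simp
  qed simp
qed

theorem theorem1p2:
  fixes \<phi> :: "real \<Rightarrow> complex \<Rightarrow> complex" and h :: "complex \<Rightarrow> complex" and \<Omega> :: "complex set"
  assumes "hyperbolic_semigroup \<phi>"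
    and "koenigs_function \<phi> h"
    and "\<Omega> = h ` unit_disk"
  shows
    "(left_area \<Omega> = \<infinity> \<longrightarrow> dirichlet_point_spectrum \<phi> = {0}) \<and>
     (left_area \<Omega> < \<infinity> \<and> has_decay_rate \<Omega> \<infinity> \<longrightarrow>
        dirichlet_point_spectrum \<phi> = {\<mu>. Re \<mu> < 0} \<union> {0}) \<and>
     (\<forall>\<delta>::real. left_area \<Omega> < \<infinity> \<and> has_decay_rate \<Omega> (ereal \<delta>) \<and> 0 < \<delta> \<and>
        weighted_left_area \<Omega> \<delta> < \<infinity> \<longrightarrow>
        dirichlet_point_spectrum \<phi> = {\<mu>. - \<delta> \<le> Re \<mu> \<and> Re \<mu> < 0} \<union> {0}) \<and>
     (\<forall>\<delta>::real. left_area \<Omega> < \<infinity> \<and> has_decay_rate \<Omega> (ereal \<delta>) \<and> 0 < \<delta> \<and>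
        weighted_left_area \<Omega> \<delta> = \<infinity> \<longrightarrow>
        dirichlet_point_spectrum \<phi> = {\<mu>. - \<delta> < Re \<mu> \<and> Re \<mu> < 0} \<union> {0}) \<and>
     (left_area \<Omega> < \<infinity> \<and> has_decay_rate \<Omega> 0 \<longrightarrow> dirichlet_point_spectrum \<phi> = {0})"
proof -
  have \<Omega>: "open \<Omega>"
    using koenigs_domain_open_connected[OF assms(2)] assms(3) by simp
  have spectrum: "dirichlet_point_spectrum \<phi> = {\<mu>. Re \<mu> < 0 \<and> weighted_left_area \<Omega> (- Re \<mu>) < \<infinity>} \<union> {0}"
    using dirichlet_point_spectrum_iff[OF assms(1,2)] assms(3) by blast
  note finite = weighted_left_area_finite_below_decay_rate[OF \<Omega>]
  note infinite = weighted_left_area_infinite_above_decay_rate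
  show ?thesis
  proof (intro conjI impI allI; (elim conjE)?)
    assume "left_area \<Omega> = \<infinity>"
    then have "weighted_left_area \<Omega> (- Re \<mu>) = \<infinity>" if "Re \<mu> < 0" for \<mu>
      using left_area_le_weighted_left_area[of "- Re \<mu>" \<Omega>] that by (simp add: top.extremum_unique)
    then show "dirichlet_point_spectrum \<phi> = {0}"
      unfolding spectrum by auto
  next
    assume "left_area \<Omega> < \<infinity>" "has_decay_rate \<Omega> \<infinity>"
    then have "weighted_left_area \<Omega> (- Re \<mu>) < \<infinity>" if "Re \<mu> < 0" for \<mu>
      using that by (intro finite[of \<infinity>]) auto
    then show "dirichlet_point_spectrum \<phi> = {\<mu>. Re \<mu> < 0} \<union> {0}"
      unfolding spectrum by auto
  next
    fix \<delta> :: real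
    assume *: "left_area \<Omega> < \<infinity>" "has_decay_rate \<Omega> (ereal \<delta>)" "0 < \<delta>" "weighted_left_area \<Omega> \<delta> < \<infinity>"
    have "weighted_left_area \<Omega> (- Re \<mu>) < \<infinity> \<longleftrightarrow> - \<delta> \<le> Re \<mu>" if "Re \<mu> < 0" for \<mu>
    proof (cases "- Re \<mu>" \<delta> rule: linorder_cases)
      case less
      then show ?thesis using finite[OF *(1,2), of "- Re \<mu>"] that by simp
    next
      case equal
      then show ?thesis using *(4) by auto
    next
      case greater
      then show ?thesis using infinite[OF *(2), of "- Re \<mu>"] by simp
    qed
    then show "dirichlet_point_spectrum \<phi> = {\<mu>. - \<delta> \<le> Re \<mu> \<and> Re \<mu> < 0} \<union> {0}"
      unfolding spectrum by auto
  next
    fix \<delta> :: real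
    assume *: "left_area \<Omega> < \<infinity>" "has_decay_rate \<Omega> (ereal \<delta>)" "0 < \<delta>" "weighted_left_area \<Omega> \<delta> = \<infinity>"
    have "weighted_left_area \<Omega> (- Re \<mu>) < \<infinity> \<longleftrightarrow> - \<delta> < Re \<mu>" if "Re \<mu> < 0" for \<mu>
    proof (cases "- Re \<mu>" \<delta> rule: linorder_cases)
      case less
      then show ?thesis using finite[OF *(1,2), of "- Re \<mu>"] that by simp
    next
      case equal
      then show ?thesis using *(4) by auto
    next
      case greater
      then show ?thesis using infinite[OF *(2), of "- Re \<mu>"] by simp
    qed
    then show "dirichlet_point_spectrum \<phi> = {\<mu>. - \<delta> < Re \<mu> \<and> Re \<mu> < 0} \<union> {0}"
      unfolding spectrum by auto
  next
    assume "left_area \<Omega> < \<infinity>" "has_decay_rate \<Omega> 0"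
    then have "weighted_left_area \<Omega> (- Re \<mu>) = \<infinity>" if "Re \<mu> < 0" for \<mu>
      using that by (intro infinite[of _ 0]) auto
    then show "dirichlet_point_spectrum \<phi> = {0}"
      unfolding spectrum by auto
  qed
qed

end
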